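(* The alternator ideal $I(\mathbb{M})$ of $U(\mathbb{M})$ is generated, as a two-sided ideal of $U(\mathbb{M})$, by the two elements $ce$ and $e^2$.
   Context: Let $\mathbb{F}$ be a field of characteristic $\ne 2,3$. $\mathbb{M}$ is the 5-dimensional nilpotent (non-Lie) Malcev algebra over $\mathbb{F}$ with basis $a,b,c,d,e$ and anticommutative product determined by $[a,b]=c$, $[c,d]=e$ (so $[b,a]=-c$, $[d,c]=-e$), all other products of basis elements being $0$. The universal nonassociative enveloping algebra is $U(\mathbb{M})=F(\mathbb{M})/R(\mathbb{M})$, where $F(\mathbb{M})$ is the unital free nonassociative $\mathbb{F}$-algebra on $\{a,b,c,d,e\}$ (with $\mathbb{M}$ viewed as the span of the generators) and $R(\mathbb{M})$ is the two-sided ideal generated by $fg-gf-[f,g]$, $(f,x,y)+(x,f,y)$, $(x,f,y)+(x,y,f)$ for all $f,g\in\mathbb{M}$, $x,y\in F(\mathbb{M})$; here $(x,y,z)=(xy)z-x(yz)$. By a theorem of Pérez-Izquierdo and Shestakov, $\mathbb{M}\to U(\mathbb{M})$ is injective, and we identify $\mathbb{M}$ with its image. The alternator ideal $I(\mathbb{M})$ is the two-sided ideal of $U(\mathbb{M})$ generated by all $(x,x,y)$ and $(y,x,x)$ with $x,y\in U(\mathbb{M})$. *)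

theory Defs
  imports Complex_Main "HOL-Library.Poly_Mapping"
begin

section \<open>Unital nonassociative algebras over a field\<close>

locale nonassoc_algebra = vector_space scale
  for scale :: "'k::field \<Rightarrow> 'b::ab_group_add \<Rightarrow> 'b" (infixr \<open>*s\<close> 75) +
  fixes mult :: "'b \<Rightarrow> 'b \<Rightarrow> 'b" (infixl \<open>\<odot>\<close> 70)
    and unit :: 'b
  assumes mult_add_left: "(x + y) \<odot> z = x \<odot> z + y \<odot> z"
    and mult_add_right: "x \<odot> (y + z) = x \<odot> y + x \<odot> z"
    and mult_scale_left: "(r *s x) \<odot> y = r *s (x \<odot> y)"
    and mult_scale_right: "x \<odot> (r *s y) = r *s (x \<odot> y)"
    and unit_left: "unit \<odot> x = x"
    and unit_right: "x \<odot> unit = x"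
begin

definition associator :: "'b \<Rightarrow> 'b \<Rightarrow> 'b \<Rightarrow> 'b" where
  "associator x y z = (x \<odot> y) \<odot> z - x \<odot> (y \<odot> z)"

definition two_sided_ideal :: "'b set \<Rightarrow> bool" where
  "two_sided_ideal I \<longleftrightarrow> subspace I \<and> (\<forall>x. \<forall>y\<in>I. x \<odot> y \<in> I \<and> y \<odot> x \<in> I)"

definition ideal_generated :: "'b set \<Rightarrow> 'b set" where
  "ideal_generated S = two_sided_ideal hull S"

definition alternator_ideal :: "'b set" where
  "alternator_ideal =
     ideal_generated ({associator x x y | x y. True} \<union> {associator y x x | x y. True})"

lemma mult_diff_left: "(x - y) \<odot> z = x \<odot> z - y \<odot> z"
  using mult_add_left[of "x - y" y z] by (simp add: algebra_simps)

lemma mult_diff_right: "x \<odot> (y - z) = x \<odot> y - x \<odot> z"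
  using mult_add_right[of x "y - z" z] by (simp add: algebra_simps)

lemma two_sided_ideal_ideal_generated: "two_sided_ideal (ideal_generated S)"
  unfolding ideal_generated_def
  by (rule hull_in) (auto simp: two_sided_ideal_def intro: subspace_Inter)

end


section \<open>Finitely supported functions as free modules\<close>

definition pm_scale :: "'k::field \<Rightarrow> ('i \<Rightarrow>\<^sub>0 'k) \<Rightarrow> ('i \<Rightarrow>\<^sub>0 'k)" where
  "pm_scale r f = Poly_Mapping.map ((*) r) f"

text \<open>The bilinear extension of a product \<open>m\<close> prescribed on basis elements.\<close>

definition pm_bilinear ::
  "('i \<Rightarrow> 'i \<Rightarrow> ('j \<Rightarrow>\<^sub>0 'k)) \<Rightarrow> ('i \<Rightarrow>\<^sub>0 'k) \<Rightarrow> ('i \<Rightarrow>\<^sub>0 'k) \<Rightarrow> ('j \<Rightarrow>\<^sub>0 'k::field)" where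
  "pm_bilinear m f g =
     (\<Sum>i\<in>Poly_Mapping.keys f. \<Sum>j\<in>Poly_Mapping.keys g.
        pm_scale (Poly_Mapping.lookup f i * Poly_Mapping.lookup g j) (m i j))"

lemma lookup_pm_scale [simp]:
  "Poly_Mapping.lookup (pm_scale r f) i = r * Poly_Mapping.lookup f i"
  by (simp add: pm_scale_def Poly_Mapping.map.rep_eq when_def)

interpretation pm: vector_space "pm_scale :: 'k::field \<Rightarrow> ('i \<Rightarrow>\<^sub>0 'k) \<Rightarrow> _"
  by standard (auto intro!: poly_mapping_eqI simp: lookup_add algebra_simps)

lemma pm_bilinear_superset:
  assumes "finite A" "finite B" "Poly_Mapping.keys f \<subseteq> A" "Poly_Mapping.keys g \<subseteq> B"
  shows "pm_bilinear m f g = (\<Sum>i\<in>A. \<Sum>j\<in>B.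
           pm_scale (Poly_Mapping.lookup f i * Poly_Mapping.lookup g j) (m i j))"
proof -
  have "pm_bilinear m f g = (\<Sum>i\<in>Poly_Mapping.keys f. \<Sum>j\<in>B.
           pm_scale (Poly_Mapping.lookup f i * Poly_Mapping.lookup g j) (m i j))"
    unfolding pm_bilinear_def
    by (intro sum.cong refl sum.mono_neutral_left) (use assms in \<open>auto simp: in_keys_iff\<close>)
  also have "\<dots> = (\<Sum>i\<in>A. \<Sum>j\<in>B.
           pm_scale (Poly_Mapping.lookup f i * Poly_Mapping.lookup g j) (m i j))"
    by (intro sum.mono_neutral_left) (use assms in \<open>auto simp: in_keys_iff\<close>)
  finally show ?thesis .
qed

lemma keys_pm_scale_subset: "Poly_Mapping.keys (pm_scale r f) \<subseteq> Poly_Mapping.keys f"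
  by (auto simp: in_keys_iff)

lemma pm_bilinear_add_left: "pm_bilinear m (f + g) h = pm_bilinear m f h + pm_bilinear m g h"
  using keys_add[of f g]
  by (simp add: pm_bilinear_superset[where A="Poly_Mapping.keys f \<union> Poly_Mapping.keys g"
        and B="Poly_Mapping.keys h"] lookup_add sum.distrib[symmetric] distrib_right
      pm.scale_left_distrib)

lemma pm_bilinear_add_right: "pm_bilinear m h (f + g) = pm_bilinear m h f + pm_bilinear m h g"
  using keys_add[of f g]
  by (simp add: pm_bilinear_superset[where B="Poly_Mapping.keys f \<union> Poly_Mapping.keys g"
        and A="Poly_Mapping.keys h"] lookup_add sum.distrib[symmetric] distrib_left
      pm.scale_left_distrib)

lemma pm_bilinear_scale_left: "pm_bilinear m (pm_scale r f) h = pm_scale r (pm_bilinear m f h)"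
  using keys_pm_scale_subset[of r f]
  by (simp add: pm_bilinear_superset[where A="Poly_Mapping.keys f"
        and B="Poly_Mapping.keys h"] pm.scale_sum_right mult.assoc)

lemma pm_bilinear_scale_right: "pm_bilinear m h (pm_scale r f) = pm_scale r (pm_bilinear m h f)"
  using keys_pm_scale_subset[of r f]
  by (simp add: pm_bilinear_superset[where B="Poly_Mapping.keys f"
        and A="Poly_Mapping.keys h"] pm.scale_sum_right mult.assoc mult.left_commute)


section \<open>The unital free nonassociative algebra\<close>

datatype 'x magma = Gen 'x | Mul "'x magma" "'x magma"

text \<open>
  The monomial basis is the free magma with a unit adjoined; the unit is \<^const>\<open>None\<close>.
\<close>

type_synonym ('x, 'k) free_nonassoc = "'x magma option \<Rightarrow>\<^sub>0 'k"

fun mono_mult :: "'x magma option \<Rightarrow> 'x magma option \<Rightarrow> 'x magma option" where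
  "mono_mult None v = v"
| "mono_mult (Some u) None = Some u"
| "mono_mult (Some u) (Some v) = Some (Mul u v)"

definition free_mult ::
  "('x, 'k::field) free_nonassoc \<Rightarrow> ('x, 'k) free_nonassoc \<Rightarrow> ('x, 'k) free_nonassoc"
  (infixl \<open>\<bullet>\<close> 70) where
  "f \<bullet> g = pm_bilinear (\<lambda>u v. Poly_Mapping.single (mono_mult u v) 1) f g"

definition free_one :: "('x, 'k::field) free_nonassoc" where
  "free_one = Poly_Mapping.single None 1"

definition free_gen :: "'x \<Rightarrow> ('x, 'k::field) free_nonassoc" where
  "free_gen x = Poly_Mapping.single (Some (Gen x)) 1"

lemma mono_mult_None_right [simp]: "mono_mult u None = u"
  by (cases u) auto

lemma sum_pm_scale_single:
  "(\<Sum>i\<in>Poly_Mapping.keys f. pm_scale (Poly_Mapping.lookup f i) (Poly_Mapping.single i 1)) = f"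
  by (rule poly_mapping_eqI)
     (auto simp: lookup_sum lookup_single when_def in_keys_iff if_distrib cong: if_cong)

global_interpretation free: nonassoc_algebra
  "pm_scale :: 'k::field \<Rightarrow> ('x, 'k) free_nonassoc \<Rightarrow> _" free_mult free_one
proof
  fix x y z :: "('x, 'k) free_nonassoc" and r :: 'k
  show "(x + y) \<bullet> z = x \<bullet> z + y \<bullet> z" "x \<bullet> (y + z) = x \<bullet> y + x \<bullet> z"
    by (simp_all add: free_mult_def pm_bilinear_add_left pm_bilinear_add_right)
  show "pm_scale r x \<bullet> y = pm_scale r (x \<bullet> y)" "x \<bullet> pm_scale r y = pm_scale r (x \<bullet> y)"
    by (simp_all add: free_mult_def pm_bilinear_scale_left pm_bilinear_scale_right)
  show "free_one \<bullet> x = x" "x \<bullet> free_one = x"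
    by (simp_all add: free_mult_def free_one_def pm_bilinear_def sum_pm_scale_single)
qed


section \<open>The Malcev algebra\<close>

datatype mbasis = m\<^sub>a | m\<^sub>b | m\<^sub>c | m\<^sub>d | m\<^sub>e

type_synonym 'k malcev = "mbasis \<Rightarrow>\<^sub>0 'k"

fun basis_bracket :: "mbasis \<Rightarrow> mbasis \<Rightarrow> 'k::field malcev" where
  "basis_bracket m\<^sub>a m\<^sub>b = Poly_Mapping.single m\<^sub>c 1"
| "basis_bracket m\<^sub>b m\<^sub>a = - Poly_Mapping.single m\<^sub>c 1"
| "basis_bracket m\<^sub>c m\<^sub>d = Poly_Mapping.single m\<^sub>e 1"
| "basis_bracket m\<^sub>d m\<^sub>c = - Poly_Mapping.single m\<^sub>e 1"
| "basis_bracket _ _ = 0"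

definition bracket :: "'k::field malcev \<Rightarrow> 'k malcev \<Rightarrow> 'k malcev" where
  "bracket = pm_bilinear basis_bracket"


section \<open>The universal nonassociative enveloping algebra\<close>

definition malcev_to_free :: "'k::field malcev \<Rightarrow> (mbasis, 'k) free_nonassoc" where
  "malcev_to_free f =
     (\<Sum>i\<in>Poly_Mapping.keys f. pm_scale (Poly_Mapping.lookup f i) (free_gen i))"

lemma malcev_to_free_basis: "malcev_to_free (Poly_Mapping.single i 1) = free_gen i"
  by (simp add: malcev_to_free_def)

definition env_relators :: "(mbasis, 'k::field) free_nonassoc set" where
  "env_relators =
     {malcev_to_free f \<bullet> malcev_to_free g - malcev_to_free g \<bullet> malcev_to_free f
        - malcev_to_free (bracket f g) | f g. True}
   \<union> {free.associator (malcev_to_free f) x y + free.associator x (malcev_to_free f) y | f x y. True}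
   \<union> {free.associator x (malcev_to_free f) y + free.associator x y (malcev_to_free f) | f x y. True}"

definition env_ideal :: "(mbasis, 'k::field) free_nonassoc set" where
  "env_ideal = free.ideal_generated env_relators"

definition env_rel ::
  "(mbasis, 'k::field) free_nonassoc \<Rightarrow> (mbasis, 'k) free_nonassoc \<Rightarrow> bool" where
  "env_rel x y \<longleftrightarrow> x - y \<in> env_ideal"

lemma env_ideal: "free.two_sided_ideal env_ideal"
  unfolding env_ideal_def by (rule free.two_sided_ideal_ideal_generated)

lemma env_ideal_subspace: "pm.subspace env_ideal"
  using env_ideal unfolding free.two_sided_ideal_def by blast

lemma env_ideal_mult:
  assumes "x \<in> env_ideal" shows "y \<bullet> x \<in> env_ideal" "x \<bullet> y \<in> env_ideal"
  using env_ideal assms unfolding free.two_sided_ideal_def by blast+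

lemma equivp_env_rel: "equivp (env_rel :: (mbasis, 'k::field) free_nonassoc \<Rightarrow> _)" (is "equivp ?r")
proof (rule equivpI)
  show "reflp ?r"
    by (rule reflpI) (simp add: env_rel_def pm.subspace_0[OF env_ideal_subspace])
  show "symp ?r"
    by (rule sympI) (metis env_rel_def minus_diff_eq pm.subspace_neg[OF env_ideal_subspace])
  show "transp ?r"
  proof (rule transpI)
    fix x y z :: "(mbasis, 'k) free_nonassoc"
    assume "env_rel x y" "env_rel y z"
    then have "(x - y) + (y - z) \<in> env_ideal"
      unfolding env_rel_def by (rule pm.subspace_add[OF env_ideal_subspace])
    then show "?r x z" unfolding env_rel_def by simp
  qed
qed

quotient_type (overloaded) 'k malcev_env = "(mbasis, 'k::field) free_nonassoc" / env_rel
  by (rule equivp_env_rel)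

text \<open>
  The images in the enveloping algebra of the basis elements of the Malcev algebra; a basis element
  and its image are identified on paper.
\<close>

lift_definition env_gen :: "mbasis \<Rightarrow> 'k::field malcev_env" is free_gen .

lift_definition env_scale :: "'k::field \<Rightarrow> 'k malcev_env \<Rightarrow> 'k malcev_env" is pm_scale
  unfolding env_rel_def
  by (metis pm.scale_right_diff_distrib pm.subspace_scale[OF env_ideal_subspace])

instantiation malcev_env :: (field) "{ab_group_add, one, times}"
begin

lift_definition zero_malcev_env :: "'a malcev_env" is 0 .

lift_definition one_malcev_env :: "'a malcev_env" is free_one .

lift_definition plus_malcev_env :: "'a malcev_env \<Rightarrow> 'a malcev_env \<Rightarrow> 'a malcev_env" is "(+)"
  unfolding env_rel_def by (metis add_diff_add pm.subspace_add[OF env_ideal_subspace])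

lift_definition uminus_malcev_env :: "'a malcev_env \<Rightarrow> 'a malcev_env" is uminus
  unfolding env_rel_def
  by (metis minus_diff_minus pm.subspace_neg[OF env_ideal_subspace])

lift_definition minus_malcev_env :: "'a malcev_env \<Rightarrow> 'a malcev_env \<Rightarrow> 'a malcev_env" is "(-)"
proof -
  fix x x' y y' :: "(mbasis, 'a) free_nonassoc"
  assume "env_rel x x'" "env_rel y y'"
  then have "(x - x') - (y - y') \<in> env_ideal"
    unfolding env_rel_def by (rule pm.subspace_diff[OF env_ideal_subspace])
  then show "env_rel (x - y) (x' - y')" by (simp add: env_rel_def algebra_simps)
qed

lift_definition times_malcev_env :: "'a malcev_env \<Rightarrow> 'a malcev_env \<Rightarrow> 'a malcev_env" is free_mult
proof -
  fix x x' y y' :: "(mbasis, 'a) free_nonassoc"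
  assume "env_rel x x'" "env_rel y y'"
  then have "(x - x') \<bullet> y + x' \<bullet> (y - y') \<in> env_ideal"
    unfolding env_rel_def by (intro pm.subspace_add[OF env_ideal_subspace] env_ideal_mult)
  then show "env_rel (x \<bullet> y) (x' \<bullet> y')"
    by (simp add: env_rel_def free.mult_diff_left free.mult_diff_right)
qed

instance
proof
  fix x y z :: "'a malcev_env"
  have refl: "env_rel u u" for u :: "(mbasis, 'a) free_nonassoc"
    by (rule equivp_reflp[OF equivp_env_rel])
  show "x + y + z = x + (y + z)" by transfer (simp add: add.assoc refl)
  show "x + y = y + x" by transfer (simp add: add.commute refl)
  show "0 + x = x" by transfer (simp add: refl)
  show "- x + x = 0" by transfer (simp add: refl)
  show "x - y = x + - y" by transfer (simp add: refl)
qed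

end

global_interpretation env: nonassoc_algebra
  "env_scale :: 'k::field \<Rightarrow> 'k malcev_env \<Rightarrow> _" "(*)" 1
proof
  fix x y z :: "'k malcev_env" and r s :: 'k
  have refl: "env_rel u u" for u :: "(mbasis, 'k) free_nonassoc"
    by (rule equivp_reflp[OF equivp_env_rel])
  show "env_scale r (x + y) = env_scale r x + env_scale r y"
    by transfer (simp add: pm.scale_right_distrib refl)
  show "env_scale (r + s) x = env_scale r x + env_scale s x"
    by transfer (simp add: pm.scale_left_distrib refl)
  show "env_scale r (env_scale s x) = env_scale (r * s) x"
    by transfer (simp add: refl)
  show "env_scale 1 x = x"
    by transfer (simp add: refl)
  show "(x + y) * z = x * z + y * z"
    by transfer (simp add: free.mult_add_left refl)
  show "x * (y + z) = x * y + x * z"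
    by transfer (simp add: free.mult_add_right refl)
  show "env_scale r x * y = env_scale r (x * y)"
    by transfer (simp add: free.mult_scale_left refl)
  show "x * env_scale r y = env_scale r (x * y)"
    by transfer (simp add: free.mult_scale_right refl)
  show "1 * x = x"
    by transfer (simp add: free.unit_left refl)
  show "x * 1 = x"
    by transfer (simp add: free.unit_right refl)
qed

end

theory Submission
  imports Defs
begin

text \<open>
  Elements of the Malcev algebra \<open>M\<close> lie in the generalized alternative nucleus, so for \<open>f\<close>, \<open>g\<close> in \<open>M\<close>
  and arbitrary \<open>x\<close>, \<open>y\<close> one has \<open>6 (f, g, x) = [[x, f], g] - [[x, g], f] - [x, [f, g]]\<close> and
  \<open>[x y, f] = x [y, f] + [x, f] y + 3 (f, x, y)\<close>. Inductions on the degree of right-normed monomials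
  then show that \<open>e\<close> is central, and that modulo \<open>e\<close> the enveloping algebra is associative with \<open>c\<close>
  central. After imposing \<open>c e = 0\<close> and \<open>e e = 0\<close>, all associators are multiples of \<open>e\<close>, on which the
  algebra acts through its quotient by \<open>c\<close> and \<open>e\<close>, the polynomial ring in \<open>a\<close>, \<open>b\<close>, \<open>d\<close>. There the
  associator is skew-symmetric and a derivation in each argument, like the Jacobian determinant with
  respect to \<open>a\<close>, \<open>b\<close>, \<open>d\<close> times \<open>e / 6\<close>; in particular the quotient is alternative.
  Conversely, \<open>6 (d, a b, a b) = - c e\<close> holds in the enveloping algebra, and
  \<open>e e = [c, d] e = (c e) d - d (c e)\<close>.
\<close>

section \<open>Commutators and associators\<close>

context nonassoc_algebra
begin

definition commutator :: "'b \<Rightarrow> 'b \<Rightarrow> 'b" where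
  "commutator x y = x \<odot> y - y \<odot> x"

lemma mult_zero_left [simp]: "0 \<odot> x = 0"
  using mult_add_left[of 0 0 x] by simp

lemma mult_zero_right [simp]: "x \<odot> 0 = 0"
  using mult_add_right[of x 0 0] by simp

lemma mult_minus_left [simp]: "(- x) \<odot> y = - (x \<odot> y)"
  using mult_diff_left[of 0 x y] by simp

lemma mult_minus_right [simp]: "x \<odot> (- y) = - (x \<odot> y)"
  using mult_diff_right[of x 0 y] by simp

lemmas mult_distribs = mult_add_left mult_add_right mult_diff_left mult_diff_right

lemma commutator_self [simp]: "commutator x x = 0"
  by (simp add: commutator_def)

lemma commutator_zero [simp]: "commutator 0 x = 0" "commutator x 0 = 0"
  by (simp_all add: commutator_def)

lemma commutator_swap: "commutator x y = - commutator y x"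
  by (simp add: commutator_def)

lemma commutator_add:
  "commutator (x + y) z = commutator x z + commutator y z"
  "commutator z (x + y) = commutator z x + commutator z y"
  by (simp_all add: commutator_def mult_distribs algebra_simps)

lemma commutator_minus [simp]:
  "commutator (- x) z = - commutator x z" "commutator z (- x) = - commutator z x"
  by (simp_all add: commutator_def)

lemma commutator_diff:
  "commutator (x - y) z = commutator x z - commutator y z"
  "commutator z (x - y) = commutator z x - commutator z y"
  by (simp_all add: commutator_def mult_distribs algebra_simps)

lemma commutator_scale:
  "commutator (r *s x) z = r *s commutator x z" "commutator z (r *s x) = r *s commutator z x"
  by (simp_all add: commutator_def mult_scale_left mult_scale_right scale_right_diff_distrib)

lemma associator_add:
  "associator (x + x') y z = associator x y z + associator x' y z"
  "associator x (y + y') z = associator x y z + associator x y' z"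
  "associator x y (z + z') = associator x y z + associator x y z'"
  by (simp_all add: associator_def mult_distribs algebra_simps)

lemma associator_diff:
  "associator (x - x') y z = associator x y z - associator x' y z"
  "associator x (y - y') z = associator x y z - associator x y' z"
  "associator x y (z - z') = associator x y z - associator x y z'"
  by (simp_all add: associator_def mult_distribs algebra_simps)

lemma associator_scale:
  "associator (r *s x) y z = r *s associator x y z"
  "associator x (r *s y) z = r *s associator x y z"
  "associator x y (r *s z) = r *s associator x y z"
  by (simp_all add: associator_def mult_scale_left mult_scale_right scale_right_diff_distrib)

lemma associator_zero [simp]:
  "associator 0 y z = 0" "associator x 0 z = 0" "associator x y 0 = 0"
  by (simp_all add: associator_def)

lemma associator_minus [simp]:
  "associator (- x) y z = - associator x y z"
  "associator x (- y) z = - associator x y z"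
  "associator x y (- z) = - associator x y z"
  by (simp_all add: associator_def)

lemma associator_unit [simp]:
  "associator unit y z = 0" "associator x unit z = 0" "associator x y unit = 0"
  by (simp_all add: associator_def unit_left unit_right)

text \<open>Pure expansion of products of four factors. It shifts a factor between the arguments of
  an associator; the later Leibniz rules come from it and from
  \<open>commutator_mult\<close>.\<close>

lemma teichmuller:
  "associator (w \<odot> x) y z - associator w (x \<odot> y) z + associator w x (y \<odot> z)
    = w \<odot> associator x y z + associator w x y \<odot> z"
  by (simp add: associator_def mult_distribs algebra_simps)

lemma scale_3: "3 *s x = x + x + x"
proof -
  have "(1 + 1 + 1) *s x = x + x + x"
    unfolding scale_left_distrib by simp
  then show ?thesis by simp
qed

lemma scale_2: "2 *s x = x + x"
proof -
  have "(1 + 1) *s x = x + x"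
    unfolding scale_left_distrib by simp
  then show ?thesis by simp
qed

lemma scale_6: "6 *s x = x + x + x + x + x + x"
proof -
  have "(3 + 3) *s x = (x + x + x) + (x + x + x)"
    unfolding scale_left_distrib scale_3 ..
  then show ?thesis by (simp add: add.assoc)
qed

text \<open>The Akivis identity of arbitrary nonassociative algebras: the failure of the Jacobi
  identity is the alternating sum of associators. It turns associators into commutators in
  \<open>six_associator\<close>.\<close>

lemma akivis:
  "commutator (commutator x y) z + commutator (commutator y z) x + commutator (commutator z x) y
    = associator x y z + associator y z x + associator z x y
      - associator x z y - associator z y x - associator y x z"
  by (simp add: associator_def commutator_def mult_distribs algebra_simps)

lemma two_sided_idealD:
  assumes "two_sided_ideal I"
  shows "subspace I" "y \<in> I \<Longrightarrow> x \<odot> y \<in> I" "y \<in> I \<Longrightarrow> y \<odot> x \<in> I"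
  using assms by (auto simp: two_sided_ideal_def)

lemma commutator_unit [simp]: "commutator unit x = 0" "commutator x unit = 0"
  by (simp_all add: commutator_def unit_left unit_right)

section \<open>Linear predicates as subspaces\<close>

lemma subspace_preimage:
  assumes "\<And>x y. T (x + y) = T x + T y" "\<And>r x. T (r *s x) = r *s T x" "subspace S"
  shows "subspace {x. T x \<in> S}"
proof -
  have "T 0 = 0" using assms(1)[of 0 0] by simp
  then show ?thesis using assms by (auto simp: subspace_def)
qed

lemma subspace_Ball: "(\<And>y. y \<in> A \<Longrightarrow> subspace {x. P x y}) \<Longrightarrow> subspace {x. \<forall>y\<in>A. P x y}"
  by (auto simp: subspace_def)

lemma subspace_All: "(\<And>y. subspace {x. P x y}) \<Longrightarrow> subspace {x. \<forall>y. P x y}"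
  by (auto simp: subspace_def)

lemma subspace_conj: "subspace {x. P x} \<Longrightarrow> subspace {x. Q x} \<Longrightarrow> subspace {x. P x \<and> Q x}"
  by (auto simp: subspace_def)

lemma subspace_eq:
  assumes "\<And>x y. S (x + y) = S x + S y" "\<And>r x. S (r *s x) = r *s S x"
    and "\<And>x y. T (x + y) = T x + T y" "\<And>r x. T (r *s x) = r *s T x"
  shows "subspace {x. S x = T x}"
proof -
  have "S 0 = 0" "T 0 = 0" using assms(1,3)[of 0 0] by simp_all
  then show ?thesis using assms by (simp add: subspace_def)
qed

lemma ideal_commutator:
  assumes "two_sided_ideal I" "x \<in> I"
  shows "commutator x y \<in> I" "commutator y x \<in> I"
  using two_sided_idealD[OF assms(1)] assms(2) unfolding commutator_def
  by (auto intro!: subspace_diff)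

end

section \<open>Algebras generated by their generalized alternative nucleus\<close>

text \<open>The span of \<open>G\<close> plays the role of the Malcev algebra in its enveloping algebra.\<close>

locale alt_generated = nonassoc_algebra scale mult unit
  for scale :: "'k::field \<Rightarrow> 'b::ab_group_add \<Rightarrow> 'b" (infixr \<open>*s\<close> 75)
    and mult :: "'b \<Rightarrow> 'b \<Rightarrow> 'b" (infixl \<open>\<odot>\<close> 70)
    and unit :: 'b +
  fixes G :: "'b set"
  assumes two_neq_0: "(2::'k) \<noteq> 0" and three_neq_0: "(3::'k) \<noteq> 0"
    and gen_swap_left: "f \<in> G \<Longrightarrow> associator f x y + associator x f y = 0"
    and gen_swap_right: "f \<in> G \<Longrightarrow> associator x f y + associator x y f = 0"
    and gen_commutator: "f \<in> G \<Longrightarrow> g \<in> G \<Longrightarrow> commutator f g \<in> span G"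
    and gen_induct: "\<lbrakk>subspace S; unit \<in> S; G \<subseteq> S; \<And>x y. x \<in> S \<Longrightarrow> y \<in> S \<Longrightarrow> x \<odot> y \<in> S\<rbrakk> \<Longrightarrow> x \<in> S"
begin

abbreviation M :: "'b set" where "M \<equiv> span G"

lemma six_neq_0: "(6::'k) \<noteq> 0"
proof -
  have "(6::'k) = 2 * 3" by simp
  then show ?thesis using two_neq_0 three_neq_0 by (metis mult_eq_0_iff)
qed

lemma subspace_cancel:
  assumes "subspace I" "r *s x \<in> I" "r \<noteq> 0"
  shows "x \<in> I"
  using subspace_scale[OF assms(1,2), of "inverse r"] assms(3) by simp

section \<open>Skew-symmetry of associators with arguments in \<open>M\<close>\<close>

lemma M_swap_left: assumes "f \<in> M" shows "associator x f y = - associator f x y"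
  using assms
proof (induction rule: span_induct)
  case base
  show ?case
    by (auto simp: subspace_def associator_add associator_scale)
next
  case (step f)
  then show ?case using gen_swap_left[of f x y] by (simp add: eq_neg_iff_add_eq_0 add.commute)
qed

lemma M_swap_right: assumes "f \<in> M" shows "associator x f y = - associator x y f"
  using assms
proof (induction rule: span_induct)
  case base
  show ?case
    by (auto simp: subspace_def associator_add associator_scale)
next
  case (step f)
  then show ?case using gen_swap_right[of f x y] by (simp add: eq_neg_iff_add_eq_0)
qed

lemma M_cycle: "f \<in> M \<Longrightarrow> associator x y f = associator f x y"
  using M_swap_left[of f x y] M_swap_right[of f x y] by simp

lemma M_swap: "f \<in> M \<Longrightarrow> g \<in> M \<Longrightarrow> associator f x g = - associator f g x"
  using M_swap_right[of g f x] by simp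

lemma M_anti: "f \<in> M \<Longrightarrow> g \<in> M \<Longrightarrow> associator g f x = - associator f g x"
  using M_swap_left[of f g x] by simp

lemma span_commutator:
  assumes "\<And>f g. f \<in> A \<Longrightarrow> g \<in> B \<Longrightarrow> commutator f g \<in> S" "subspace S" "f \<in> span A" "g \<in> span B"
  shows "commutator f g \<in> S"
proof -
  have 1: "commutator f g \<in> S" if "f \<in> A" "g \<in> span B" for f g
    using that(2)
  proof (induction rule: span_induct)
    case base
    show ?case using assms(2) by (auto simp: subspace_def commutator_add commutator_scale)
  next
    case (step g)
    then show ?case using assms(1) that(1) by blast
  qed
  show ?thesis using assms(3)
  proof (induction rule: span_induct)
    case base
    show ?case using assms(2) by (auto simp: subspace_def commutator_add commutator_scale)
  next
    case (step f)
    then show ?case using 1 assms(4) by blast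
  qed
qed

lemma M_commutator: "f \<in> M \<Longrightarrow> g \<in> M \<Longrightarrow> commutator f g \<in> M"
  by (rule span_commutator[of G G]) (auto intro: gen_commutator)

text \<open>With two arguments in \<open>M\<close> an associator changes by the sign of a
  permutation, so the six terms of \<open>akivis\<close> coincide up to sign. As 6 is invertible,
  associators reduce to commutators with elements of \<open>M\<close>.\<close>

lemma six_associator:
  assumes "f \<in> M" "g \<in> M"
  shows "6 *s associator f g x
    = commutator (commutator x f) g - commutator (commutator x g) f - commutator x (commutator f g)"
proof -
  have "associator x f g = associator f g x"
    using M_cycle[OF assms(1), of g x] M_cycle[OF assms(2), of x f] by simp
  moreover have "associator g x f = associator f g x"
    using M_cycle[OF assms(1), of g x] by simp
  moreover have "associator x g f = - associator f g x" "associator g f x = - associator f g x"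
    using M_swap_left[OF assms(1), of g x] M_cycle[OF assms(1), of x g] M_swap[OF assms, of x] by simp_all
  moreover have "associator f x g = - associator f g x"
    using M_swap[OF assms] .
  ultimately show ?thesis
    using akivis[of x f g] commutator_swap[of "commutator f g" x] commutator_swap[of g x]
    by (simp add: scale_6 algebra_simps)
qed

text \<open>Expansion leaves three associators, each equal to \<open>associator f x y\<close> up to
  sign; they form the defect of the derivation rule.\<close>

lemma commutator_mult:
  assumes "f \<in> M"
  shows "commutator (x \<odot> y) f = x \<odot> commutator y f + commutator x f \<odot> y + 3 *s associator f x y"
proof -
  have "commutator (x \<odot> y) f = x \<odot> commutator y f + commutator x f \<odot> y
    + associator x y f - associator x f y + associator f x y"
    by (simp add: associator_def commutator_def mult_distribs algebra_simps)
  then show ?thesis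
    using M_cycle[OF assms, of x y] M_swap_left[OF assms, of x y] by (simp add: scale_3)
qed

section \<open>The degree filtration by right-normed words\<close>

fun filt :: "nat \<Rightarrow> 'b set" where
  "filt 0 = span {unit}"
| "filt (Suc n) = span (filt n \<union> {f \<odot> x | f x. f \<in> M \<and> x \<in> filt n})"

lemma subspace_filt: "subspace (filt n)"
  by (cases n) (auto simp: subspace_span)

lemma filt_Suc: "x \<in> filt n \<Longrightarrow> x \<in> filt (Suc n)"
  by (auto intro: span_base)

lemma filt_mult: "f \<in> M \<Longrightarrow> x \<in> filt n \<Longrightarrow> f \<odot> x \<in> filt (Suc n)"
  by (auto intro: span_base)

lemma filt_mono: "m \<le> n \<Longrightarrow> x \<in> filt m \<Longrightarrow> x \<in> filt n"
  by (induction n rule: dec_induct) (use filt_Suc in auto)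

lemma filt_Suc_subset:
  assumes "subspace S" "filt n \<subseteq> S" "\<And>f x. f \<in> M \<Longrightarrow> x \<in> filt n \<Longrightarrow> f \<odot> x \<in> S"
  shows "filt (Suc n) \<subseteq> S"
  unfolding filt.simps by (rule span_minimal) (use assms in auto)

lemma filt_0_subset: "subspace S \<Longrightarrow> unit \<in> S \<Longrightarrow> filt 0 \<subseteq> S"
  unfolding filt.simps by (rule span_minimal) auto

text \<open>For a word \<open>g y\<close> the rule \<open>commutator_mult\<close> leaves
  \<open>associator f g y\<close>, and \<open>six_associator\<close> writes this through commutators
  of \<open>y\<close> with \<open>M\<close>, which the induction hypothesis keeps in
  \<open>filt n\<close>.\<close>

lemma filt_commutator: "x \<in> filt n \<Longrightarrow> f \<in> M \<Longrightarrow> commutator x f \<in> filt n"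
proof (induction n arbitrary: x f)
  case 0
  have "filt 0 \<subseteq> {x. commutator x f \<in> filt 0}"
    using subspace_filt[of 0]
    by (intro filt_0_subset subspace_preimage commutator_add commutator_scale)
      (auto intro: subspace_0 simp: commutator_unit simp del: filt.simps)
  then show ?case using 0 by blast
next
  case (Suc n)
  have "filt (Suc n) \<subseteq> {x. commutator x f \<in> filt (Suc n)}"
  proof (rule filt_Suc_subset)
    show "subspace {x. commutator x f \<in> filt (Suc n)}"
      by (intro subspace_preimage commutator_add commutator_scale subspace_filt)
    show "filt n \<subseteq> {x. commutator x f \<in> filt (Suc n)}"
      using Suc filt_Suc by blast
    fix g y assume g: "g \<in> M" and y: "y \<in> filt n"
    have "6 *s associator f g y \<in> filt n"
      unfolding six_associator[OF Suc.prems(2) g]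
      by (intro subspace_diff subspace_filt Suc.IH y g Suc.prems(2) M_commutator)
    then have "associator f g y \<in> filt n"
      using subspace_cancel[OF subspace_filt _ six_neq_0] by blast
    then show "g \<odot> y \<in> {x. commutator x f \<in> filt (Suc n)}"
      unfolding mem_Collect_eq commutator_mult[OF Suc.prems(2)]
      by (intro subspace_add subspace_scale subspace_filt filt_mult filt_Suc[where x="associator f g y"]
          Suc.IH y g M_commutator Suc.prems(2))
  qed
  then show ?case using Suc.prems(1) by blast
qed

lemma subspace_Union_filt: "subspace (\<Union>n. filt n)"
proof -
  have "x + y \<in> (\<Union>n. filt n)" if "x \<in> filt m" "y \<in> filt n" for x y m n
    using subspace_add[OF subspace_filt[of "max m n"] filt_mono[OF _ that(1)] filt_mono[OF _ that(2)]]
    by auto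
  then show ?thesis
    using subspace_0[OF subspace_filt] subspace_scale[OF subspace_filt]
    unfolding subspace_def by (auto simp del: filt.simps) blast+
qed

text \<open>
  Modulo lower degree, \<open>2 (f x) y = f (x y) + x (f y)\<close>, because the associator \<open>(f, x, y)\<close> is
  antisymmetric in its first two arguments.
\<close>

lemma filt_product:
  "x \<in> filt n \<Longrightarrow> y \<in> (\<Union>n. filt n) \<Longrightarrow> x \<odot> y \<in> (\<Union>n. filt n)"
proof (induction n arbitrary: x y)
  case 0
  have "filt 0 \<subseteq> {x. x \<odot> y \<in> (\<Union>n. filt n)}"
    by (intro filt_0_subset subspace_preimage mult_add_left mult_scale_left subspace_Union_filt)
      (use 0 in \<open>simp add: unit_left\<close>)
  then show ?case using 0 by blast
next
  case (Suc n)
  have "filt (Suc n) \<subseteq> {x. x \<odot> y \<in> (\<Union>n. filt n)}"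
  proof (intro filt_Suc_subset subspace_preimage mult_add_left mult_scale_left subspace_Union_filt)
    show "filt n \<subseteq> {x. x \<odot> y \<in> (\<Union>n. filt n)}"
      using Suc by blast
    fix f x assume f: "f \<in> M" and x: "x \<in> filt n"
    have f_closed: "f \<odot> z \<in> (\<Union>n. filt n)" if "z \<in> (\<Union>n. filt n)" for z
      using that filt_mult[OF f] by blast
    have "2 *s ((f \<odot> x) \<odot> y) = f \<odot> (x \<odot> y) + x \<odot> (f \<odot> y) - commutator x f \<odot> y"
      using M_swap_left[OF f, of x y]
      by (simp add: scale_2 associator_def commutator_def mult_distribs algebra_simps)
    also have "\<dots> \<in> (\<Union>n. filt n)"
      by (intro subspace_diff subspace_add subspace_Union_filt f_closed Suc.IH[OF x]
          Suc.IH[OF filt_commutator[OF x f]] Suc.prems)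
    finally show "f \<odot> x \<in> {x. x \<odot> y \<in> (\<Union>n. filt n)}"
      using subspace_cancel[OF subspace_Union_filt _ two_neq_0] by blast
  qed
  then show ?case using Suc.prems by blast
qed

text \<open>The union of the filtration is a subalgebra by \<open>filt_product\<close> and contains
  the unit and \<open>G\<close>, so right-normed words span the algebra.\<close>

lemma filt_exhaust: "\<exists>n. x \<in> filt n"
proof -
  have "x \<in> (\<Union>n. filt n)"
  proof (rule gen_induct)
    show "unit \<in> (\<Union>n. filt n)"
      by (rule UN_I[of 0]) (auto intro: span_base)
    show "G \<subseteq> (\<Union>n. filt n)"
    proof
      fix f assume "f \<in> G"
      then have "f \<odot> unit \<in> filt (Suc 0)"
        by (intro filt_mult) (auto intro: span_base)
      then show "f \<in> (\<Union>n. filt n)" unfolding unit_right by blast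
    qed
  qed (use filt_product subspace_Union_filt in blast)+
  then show ?thesis by blast
qed

text \<open>Since right-normed words span, a predicate that defines a subspace only has to survive
  left multiplication by \<open>M\<close>.\<close>

lemma right_normed_induct:
  assumes "subspace {x. P x}" "P unit" "\<And>f x. f \<in> M \<Longrightarrow> P x \<Longrightarrow> P (f \<odot> x)"
  shows "P x"
proof -
  have "filt n \<subseteq> {x. P x}" for n
  proof (induction n)
    case 0
    show ?case by (rule filt_0_subset) (use assms in auto)
  next
    case (Suc n)
    then show ?case by (intro filt_Suc_subset) (use assms in auto)
  qed
  then show ?thesis using filt_exhaust[of x] by blast
qed

section \<open>Centrality and associativity modulo an ideal\<close>

lemma nucleus_mod:
  assumes I: "two_sided_ideal I" and Z: "subspace Z" "Z \<subseteq> M"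
    and comm: "\<And>z f. z \<in> Z \<Longrightarrow> f \<in> M \<Longrightarrow> commutator z f \<in> Z"
    and assoc: "\<And>z f x. z \<in> Z \<Longrightarrow> f \<in> M \<Longrightarrow> associator z f x \<in> I"
    and z: "z \<in> Z"
  shows "associator z x y \<in> I"
proof -
  note sI = two_sided_idealD[OF I]
  have "\<forall>z\<in>Z. \<forall>y. associator z x y \<in> I"
  proof (induction x rule: right_normed_induct)
    case 1
    show ?case
      by (intro subspace_Ball subspace_All subspace_preimage associator_add associator_scale sI)
  next
    case 2
    show ?case using subspace_0[OF sI(1)] by simp
  next
    case (3 f x)
    show ?case
    proof (intro ballI allI)
      fix z y assume z: "z \<in> Z"
      then have zM: "z \<in> M" using Z by blast
      \<comment> \<open>Three instances of \<open>teichmuller\<close> combined, for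
        \<open>z, f, x, y\<close>, for \<open>f, z, x, y\<close> and for \<open>z, x, y, f\<close>.
        The terms that \<open>I\<close> need not contain, such as \<open>(f, z x, y)\<close>, cancel
        in the next step because \<open>f\<close> is in \<open>M\<close>.\<close>
      have "associator z (f \<odot> x) y = associator (commutator z f) x y
          + (z \<odot> associator x y f + associator z x y \<odot> f - associator z x (y \<odot> f) + associator z (x \<odot> y) f)
          + f \<odot> associator z x y + associator f z x \<odot> y - associator f z (x \<odot> y)
          + associator z f (x \<odot> y) - z \<odot> associator f x y - associator z f x \<odot> y
          + (associator f (z \<odot> x) y - associator (z \<odot> x) y f)"
        by (simp add: associator_def commutator_def mult_distribs algebra_simps)
      also have "\<dots> = associator (commutator z f) x y
          + associator z x y \<odot> f - associator z x (y \<odot> f)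
          + f \<odot> associator z x y - associator z f x \<odot> y
          + associator z f (x \<odot> y) - associator z f x \<odot> y"
        using M_cycle[OF \<open>f \<in> M\<close>, of x y] M_cycle[OF \<open>f \<in> M\<close>, of "z \<odot> x" y]
          M_anti[OF zM \<open>f \<in> M\<close>, of x] M_anti[OF zM \<open>f \<in> M\<close>, of "x \<odot> y"]
          M_swap[OF zM \<open>f \<in> M\<close>, of "x \<odot> y"]
        by (simp add: algebra_simps)
      also have "\<dots> \<in> I"
        using 3 z comm assoc by (intro subspace_diff subspace_add sI) auto
      finally show "associator z (f \<odot> x) y \<in> I" .
    qed
  qed
  then show ?thesis using z by blast
qed

text \<open>The defect of \<open>commutator (f x) z\<close> is a multiple of
  \<open>(z, f, x)\<close>, which \<open>six_associator\<close> reduces to commutators of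
  \<open>z\<close> with words no longer than \<open>x\<close> and to terms in \<open>I\<close>.
  Induction on the degree gives the first claim, then \<open>nucleus_mod\<close> the second.\<close>

lemma central_mod:
  assumes I: "two_sided_ideal I" and z: "z \<in> M" and comm: "\<And>f. f \<in> M \<Longrightarrow> commutator z f \<in> I"
  shows "commutator x z \<in> I" "associator z x y \<in> I"
proof -
  note sI = two_sided_idealD[OF I]
  \<comment> \<open>All eligible \<open>z\<close> are treated at once, since
    \<open>nucleus_mod\<close> asks for a subspace stable under commutation with
    \<open>M\<close>.\<close>
  define Z where "Z = {z. z \<in> M \<and> (\<forall>f\<in>M. commutator z f \<in> I)}"
  have "subspace {z. \<forall>f\<in>M. commutator z f \<in> I}"
    by (intro subspace_Ball subspace_preimage commutator_add commutator_scale sI)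
  then have subZ: "subspace Z"
    unfolding Z_def by (intro subspace_conj) (simp_all add: subspace_span)
  have commZ: "commutator z f \<in> Z" if "z \<in> Z" "f \<in> M" for z f
    using that ideal_commutator(1)[OF I] by (simp add: Z_def M_commutator)
  have 6: "associator z f x \<in> I" if "commutator x z \<in> I" "commutator (commutator x f) z \<in> I"
    "z \<in> Z" "f \<in> M" for z f x
  proof (rule subspace_cancel[OF sI(1) _ six_neq_0])
    have "z \<in> M" "commutator z f \<in> I" using that by (auto simp: Z_def)
    then show "6 *s associator z f x \<in> I"
      unfolding six_associator[OF \<open>z \<in> M\<close> \<open>f \<in> M\<close>]
      by (intro subspace_diff sI(1) ideal_commutator(1)[OF I that(1)] that(2)
          ideal_commutator(2)[OF I \<open>commutator z f \<in> I\<close>])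
  qed
  have "\<forall>x\<in>filt n. \<forall>z\<in>Z. commutator x z \<in> I" for n
  proof (induction n)
    case 0
    have "filt 0 \<subseteq> {x. \<forall>z\<in>Z. commutator x z \<in> I}"
      by (intro filt_0_subset subspace_Ball subspace_preimage commutator_add commutator_scale sI)
        (use subspace_0[OF sI(1)] in simp)
    then show ?case by blast
  next
    case (Suc n)
    have "filt (Suc n) \<subseteq> {x. \<forall>z\<in>Z. commutator x z \<in> I}"
    proof (intro filt_Suc_subset subspace_Ball subspace_preimage commutator_add commutator_scale sI)
      show "filt n \<subseteq> {x. \<forall>z\<in>Z. commutator x z \<in> I}" using Suc by blast
      fix f x assume f: "f \<in> M" and x: "x \<in> filt n"
      have "commutator (f \<odot> x) z \<in> I" if z: "z \<in> Z" for z
      proof -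
        have zM: "z \<in> M" and "commutator f z \<in> I"
          using z f commutator_swap[of f z] subspace_neg[OF sI(1)] by (auto simp: Z_def)
        moreover have "associator z f x \<in> I"
          using Suc x f z filt_commutator by (intro 6) auto
        ultimately show ?thesis
          unfolding commutator_mult[OF zM]
          using Suc x z by (intro subspace_add subspace_scale sI) auto
      qed
      then show "f \<odot> x \<in> {x. \<forall>z\<in>Z. commutator x z \<in> I}" by blast
    qed
    then show ?case by blast
  qed
  then have c: "commutator x z \<in> I" if "z \<in> Z" for x z
    using filt_exhaust[of x] that by blast
  have zZ: "z \<in> Z" using z comm by (simp add: Z_def)
  show "commutator x z \<in> I" by (rule c[OF zZ])
  show "associator z x y \<in> I"
  proof (rule nucleus_mod[OF I subZ _ commZ _ zZ])
    show "Z \<subseteq> M" by (auto simp: Z_def)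
  qed (auto intro: 6 c)
qed

lemma zero_ideal: "two_sided_ideal {0}"
  by (auto simp: two_sided_ideal_def)

text \<open>The Leibniz rule for \<open>6 (f, g, _)\<close>, with the defect inherited from
  \<open>commutator_mult\<close>. Each defect term is an associator of two elements of
  \<open>M\<close> with \<open>y\<close> or a commutator of \<open>y\<close>, or a commutator of
  such an associator with \<open>M\<close>, so an induction on the degree of \<open>y\<close> covers
  it.\<close>

lemma six_associator_mult:
  assumes f: "f \<in> M" and g: "g \<in> M" and h: "h \<in> M"
  shows "6 *s associator f g (h \<odot> y) = h \<odot> (6 *s associator f g y) + (6 *s associator f g h) \<odot> y
    + 3 *s (associator g h (commutator y f) - associator f h (commutator y g)
      + associator g (commutator h f) y - associator f (commutator h g) y
      + commutator (associator f h y) g - commutator (associator g h y) f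
      - associator (commutator f g) h y)"
  unfolding six_associator[OF f g] commutator_mult[OF f] commutator_mult[OF g]
    commutator_mult[OF M_commutator[OF f g]] commutator_add commutator_scale
  by (simp add: mult_distribs scale_right_distrib scale_right_diff_distrib algebra_simps)

text \<open>
  By induction on the degree, commutation with elements of \<open>M\<close> is a derivation modulo \<open>I\<close>, hence so
  is the operator \<open>6 (f, g, _)\<close>, which vanishes on \<open>M\<close>.
\<close>

lemma associative_mod:
  assumes I: "two_sided_ideal I"
    and assoc: "\<And>f g h. f \<in> M \<Longrightarrow> g \<in> M \<Longrightarrow> h \<in> M \<Longrightarrow> associator f g h \<in> I"
  shows "associator x y z \<in> I"
proof -
  note sI = two_sided_idealD[OF I]
  have "\<forall>x\<in>filt n. \<forall>f\<in>M. \<forall>g\<in>M. associator f g x \<in> I" for n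
  proof (induction n)
    case 0
    have "filt 0 \<subseteq> {x. \<forall>f\<in>M. \<forall>g\<in>M. associator f g x \<in> I}"
      by (intro filt_0_subset subspace_Ball subspace_preimage associator_add associator_scale sI)
        (use subspace_0[OF sI(1)] in simp)
    then show ?case by blast
  next
    case (Suc n)
    have "filt (Suc n) \<subseteq> {x. \<forall>f\<in>M. \<forall>g\<in>M. associator f g x \<in> I}"
    proof (intro filt_Suc_subset subspace_Ball subspace_preimage associator_add associator_scale sI)
      show "filt n \<subseteq> {x. \<forall>f\<in>M. \<forall>g\<in>M. associator f g x \<in> I}" using Suc by blast
      fix h y assume h: "h \<in> M" and y: "y \<in> filt n"
      have "associator f g (h \<odot> y) \<in> I" if f: "f \<in> M" and g: "g \<in> M" for f g
      proof (rule subspace_cancel[OF sI(1) _ six_neq_0])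
        show "6 *s associator f g (h \<odot> y) \<in> I"
          unfolding six_associator_mult[OF f g h]
          by (intro subspace_add subspace_diff subspace_scale sI(1) ideal_commutator(1)[OF I]
              sI(2)[where x=h] sI(3)[where x=y] assoc f g h Suc[rule_format] M_commutator
              filt_commutator y)
      qed
      then show "h \<odot> y \<in> {x. \<forall>f\<in>M. \<forall>g\<in>M. associator f g x \<in> I}" by blast
    qed
    then show ?case by blast
  qed
  then have MM: "associator f g x \<in> I" if "f \<in> M" "g \<in> M" for f g x
    using filt_exhaust[of x] that by blast
  \<comment> \<open>\<open>nucleus_mod\<close> with \<open>Z = M\<close> frees the second and third
    arguments; the induction below frees the first.\<close>
  have nuc: "associator f x y \<in> I" if "f \<in> M" for f x y
    by (rule nucleus_mod[OF I subspace_span[of G]]) (use that MM in \<open>auto intro: M_commutator\<close>)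
  have "\<forall>y z. associator x y z \<in> I"
  proof (induction x rule: right_normed_induct)
    case 1
    show ?case
      by (intro subspace_All subspace_preimage associator_add associator_scale sI)
  next
    case 2
    show ?case using subspace_0[OF sI(1)] by simp
  next
    case (3 f x)
    have "associator (f \<odot> x) y z \<in> I" for y z
    proof -
      have "associator (f \<odot> x) y z = associator f (x \<odot> y) z - associator f x (y \<odot> z)
        + f \<odot> associator x y z + associator f x y \<odot> z"
        using teichmuller[of f x y z] by (simp add: algebra_simps)
      also have "\<dots> \<in> I"
        using 3 by (intro subspace_add subspace_diff sI(1) sI(2)[where x=f] sI(3)[where x=z] nuc[OF 3(1)]) auto
      finally show ?thesis .
    qed
    then show ?case by blast
  qed
  then show ?thesis by blast
qed

text \<open>Three instances of \<open>teichmuller\<close> carry \<open>g\<close> along: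
  \<open>f, g, x, y\<close> moves it to the first argument, \<open>g, f, x, y\<close> exchanges it
  with \<open>f\<close>, and \<open>f, x, y, g\<close> sends it to the right end. The first two each
  contribute a copy of \<open>(f, g, x) y\<close>, hence the 2.\<close>

lemma associator_mult_middle:
  assumes f: "f \<in> M" and g: "g \<in> M"
  shows "associator f (g \<odot> x) y = associator f g (x \<odot> y) - associator f x (y \<odot> g)
    + associator f x y \<odot> g + g \<odot> associator f x y - 2 *s (associator f g x \<odot> y)
    + associator (commutator f g) x y"
proof -
  have 1: "associator f (g \<odot> x) y = associator (f \<odot> g) x y + associator f g (x \<odot> y)
      - f \<odot> associator g x y - associator f g x \<odot> y"
    using teichmuller[of f g x y] by (simp add: algebra_simps)
  have 2: "associator (f \<odot> g) x y = associator g (f \<odot> x) y + associator f g (x \<odot> y)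
      + g \<odot> associator f x y - associator f g x \<odot> y + associator (commutator f g) x y"
    using teichmuller[of g f x y] M_anti[OF f g]
    by (simp add: commutator_def associator_diff algebra_simps)
  have 3: "associator g (f \<odot> x) y = - associator f g (x \<odot> y) - associator f x (y \<odot> g)
      + f \<odot> associator g x y + associator f x y \<odot> g"
    using teichmuller[of f x y g] M_cycle[OF g, of "f \<odot> x" y] M_cycle[OF g, of x y] M_swap[OF f g]
    by (simp add: algebra_simps)
  show ?thesis
    unfolding 1 2 3 by (simp add: scale_2 algebra_simps)
qed

section \<open>The alternator \<open>(d, a b, a b)\<close>\<close>

text \<open>In the enveloping algebra, \<open>z = e / 6\<close> is the associator \<open>(d, a, b)\<close>.\<close>

lemma alternator_eq:
  assumes M: "a \<in> M" "b \<in> M" "c \<in> M" "d \<in> M" "z \<in> M"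
    and comm: "commutator a b = c" "commutator c d = 6 *s z"
      "commutator a c = 0" "commutator b c = 0" "commutator a d = 0" "commutator b d = 0"
    and central: "\<And>f. f \<in> M \<Longrightarrow> commutator z f = 0"
  shows "associator d (a \<odot> b) (a \<odot> b) = - (z \<odot> c)"
proof -
  have z_comm: "x \<odot> z = z \<odot> x" and z_nuc: "associator z x y = 0" for x y
    using central_mod[OF zero_ideal M(5), of x] central_mod(2)[OF zero_ideal M(5), of x y] central
    by (auto simp: commutator_def)
  have z_nuc': "associator x z y = 0" for x y
    using M_swap_left[OF M(5), of x y] by (simp add: z_nuc)
  have z_slide: "z \<odot> x \<odot> y = z \<odot> (x \<odot> y)" "x \<odot> (z \<odot> y) = z \<odot> (x \<odot> y)" for x y
    using z_nuc[of x y] z_nuc'[of x y] by (simp_all add: associator_def z_comm z_nuc)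
  have z_pull: "commutator z x = 0" "commutator x z = 0" "commutator (z \<odot> x) y = z \<odot> commutator x y" for x y
    by (simp_all add: commutator_def z_slide z_comm mult_distribs)
  have comm': "commutator b a = - c" "commutator d c = - (6 *s z)" "commutator c a = 0"
    "commutator c b = 0" "commutator d a = 0" "commutator d b = 0"
    using comm commutator_swap[of b a] commutator_swap[of d c] commutator_swap[of c a]
      commutator_swap[of c b] commutator_swap[of d a] commutator_swap[of d b] by simp_all
  \<comment> \<open>Associators with two arguments in \<open>M\<close> are computed as 6 times their
    value by \<open>six_associator\<close>, so the commutators of the words involved are tabulated
    first.\<close>
  have cancel6: "x = y" if "6 *s x = 6 *s y" for x y
    using that six_neq_0 by simp
  note simps = z_slide z_pull comm comm' commutator_add commutator_scale commutator_diff
    mult_scale_left mult_scale_right mult_distribs z_comm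
  have assoc_self: "associator f f x = 0" if "f \<in> M" for f x
    using M_anti[OF that that, of x] two_neq_0 scale_2[of "associator f f x"]
    by (simp add: eq_neg_iff_add_eq_0)
  \<comment> \<open>Only \<open>- [[b, a], d] = [c, d] = 6 z\<close> survives in
    \<open>six_associator\<close>.\<close>
  have dab: "associator d a b = z"
    by (rule cancel6) (simp add: six_associator M simps)
  have cab: "associator c a b = 0" and dac: "associator d a c = 0" and dbc: "associator d b c = 0"
    by (rule cancel6, simp add: six_associator M simps)+
  have acb: "associator a c b = 0" and bac: "associator b a c = 0" and dcb: "associator d c b = 0"
    using cab dbc M_anti[OF M(3,1), of b] M_cycle[OF M(3), of b a] M_cycle[OF M(1), of c b]
      M_swap[OF M(4,2), of c] by simp_all
  have ab_d: "commutator (a \<odot> b) d = 3 *s z"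
    by (simp add: commutator_mult M simps dab)
  have ab_a: "commutator (a \<odot> b) a = - (a \<odot> c)"
    by (simp add: commutator_mult M simps assoc_self)
  have ab_b: "commutator (a \<odot> b) b = c \<odot> b"
    using M_swap[OF M(2) M(2), of a] by (simp add: commutator_mult M simps assoc_self)
  have ab_c: "commutator (a \<odot> b) c = 0"
    by (simp add: commutator_mult M simps cab)
  have cb_d: "commutator (c \<odot> b) d = 6 *s (z \<odot> b)"
    by (simp add: commutator_mult M simps dcb)
  have ac_d: "commutator (a \<odot> c) d = 6 *s (z \<odot> a)"
    by (simp add: commutator_mult M simps dac)
  have ac_b: "commutator (a \<odot> c) b = c \<odot> c"
    by (simp add: commutator_mult M simps bac)
  have cb_a: "commutator (c \<odot> b) a = - (c \<odot> c)"
    by (simp add: commutator_mult M simps acb)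
  have cc_d: "commutator (c \<odot> c) d = 12 *s (z \<odot> c)"
  proof -
    have "associator d c c = 0"
      using M_cycle[OF M(3), of d c] M_swap[OF M(3,3), of d] assoc_self[OF M(3)] by simp
    then show ?thesis
      by (simp add: commutator_mult M simps scale_left_distrib[symmetric])
  qed
  note simps = simps ab_d ab_a ab_b ab_c cb_d ac_d ac_b cb_a cc_d
  have d_b_ab: "associator d b (a \<odot> b) = - (z \<odot> b)"
    by (rule cancel6) (simp add: six_associator M simps)
  have d_a_ab: "associator d a (a \<odot> b) = z \<odot> a"
    by (rule cancel6) (simp add: six_associator M simps)
  have d_c_ab: "associator d c (a \<odot> b) = 0"
    by (rule cancel6) (simp add: six_associator M simps)
  have a_b_ab: "associator a b (a \<odot> b) = 0"
    by (rule cancel6) (simp add: six_associator M simps)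
  have d_b_ac: "associator d b (a \<odot> c) = - (z \<odot> c)"
    by (rule cancel6) (simp add: six_associator M simps flip: scale_left_diff_distrib scale_minus_left)
  have d_a_cb: "associator d a (c \<odot> b) = z \<odot> c"
    by (rule cancel6) (simp add: six_associator M simps flip: scale_left_diff_distrib scale_minus_left)
  have bab_a: "commutator (b \<odot> (a \<odot> b)) a = - (b \<odot> (a \<odot> c)) - c \<odot> (a \<odot> b)"
    by (simp add: commutator_mult M simps a_b_ab)
  have bab_d: "commutator (b \<odot> (a \<odot> b)) d = 0"
    by (simp add: commutator_mult M simps d_b_ab)
  have bac_d: "commutator (b \<odot> (a \<odot> c)) d = 6 *s (z \<odot> (b \<odot> a)) - 3 *s (z \<odot> c)"
    by (simp add: commutator_mult M simps d_b_ac)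
  have cab_d: "commutator (c \<odot> (a \<odot> b)) d = 3 *s (z \<odot> c) + 6 *s (z \<odot> (a \<odot> b))"
    by (simp add: commutator_mult M simps d_c_ab)
  have d_a_bab: "associator d a (b \<odot> (a \<odot> b)) = z \<odot> (b \<odot> a) + z \<odot> (a \<odot> b)"
    by (rule cancel6) (simp add: six_associator M simps bab_a bab_d bac_d cab_d scale_right_distrib)
  have aba_d: "commutator (a \<odot> b \<odot> a) d = 0"
    by (simp add: commutator_mult M simps d_a_ab M_swap[OF M(4) M(1)])
  have "associator b (a \<odot> b) a = 0"
    using a_b_ab M_cycle[OF M(1), of b "a \<odot> b"] by (simp add: M_cycle M)
  then have aba_b: "commutator (a \<odot> b \<odot> a) b = a \<odot> b \<odot> c + c \<odot> b \<odot> a"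
    by (simp add: commutator_mult M simps)
  have abc_d: "commutator (a \<odot> b \<odot> c) d = 6 *s (z \<odot> (a \<odot> b)) + 3 *s (z \<odot> c)"
    by (simp add: commutator_mult M simps d_c_ab M_swap[OF M(4) M(3)])
  have cba_d: "commutator (c \<odot> b \<odot> a) d = 6 *s (z \<odot> (b \<odot> a)) - 3 *s (z \<odot> c)"
    by (simp add: commutator_mult M simps d_a_cb M_swap[OF M(4) M(1)])
  have d_b_aba: "associator d b (a \<odot> b \<odot> a) = - (z \<odot> (b \<odot> a) + z \<odot> (a \<odot> b))"
    by (rule cancel6) (simp add: six_associator M simps aba_b aba_d abc_d cba_d scale_right_distrib scale_right_diff_distrib)
  \<comment> \<open>With \<open>g = a\<close>, \<open>x = b\<close> and \<open>y = a b\<close>,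
    \<open>associator_mult_middle\<close> leaves only associators computed above.\<close>
  have "associator d (a \<odot> b) (a \<odot> b) = z \<odot> (b \<odot> a) - z \<odot> (a \<odot> b)"
    by (simp add: associator_mult_middle[OF M(4,1)] comm' d_a_bab d_b_aba d_b_ab dab z_slide scale_2)
  also have "\<dots> = - (z \<odot> c)"
    by (simp add: comm(1)[symmetric] commutator_def mult_distribs)
  finally show ?thesis .
qed

end

section \<open>Alternativity\<close>

text \<open>\<open>0 \<subseteq> span {e} \<subseteq> span {c, e} \<subseteq> M\<close> is a central chain.\<close>

locale two_step_chain = alt_generated scale mult unit G
  for scale :: "'k::field \<Rightarrow> 'b::ab_group_add \<Rightarrow> 'b" (infixr \<open>*s\<close> 75)
    and mult :: "'b \<Rightarrow> 'b \<Rightarrow> 'b" (infixl \<open>\<odot>\<close> 70)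
    and unit :: 'b and G :: "'b set" +
  fixes c e :: 'b
  assumes c_gen: "c \<in> G" and e_gen: "e \<in> G"
    and comm_gen: "f \<in> G \<Longrightarrow> g \<in> G \<Longrightarrow> commutator f g \<in> span {c, e}"
    and comm_gen_c: "f \<in> G \<Longrightarrow> commutator f c \<in> span {e}"
    and comm_gen_e: "f \<in> G \<Longrightarrow> commutator f e = 0"
    and ce: "c \<odot> e = 0" and ee: "e \<odot> e = 0"
begin

section \<open>The ideals \<open>E\<close> and \<open>C\<close>\<close>

lemma c_M: "c \<in> M" and e_M: "e \<in> M"
  using c_gen e_gen by (auto intro: span_base)

lemma comm_M: "f \<in> M \<Longrightarrow> g \<in> M \<Longrightarrow> commutator f g \<in> span {c, e}"
  by (rule span_commutator[of G G]) (auto intro: comm_gen)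

lemma comm_M_c: "f \<in> M \<Longrightarrow> commutator f c \<in> span {e}"
  by (rule span_commutator[of G "{c}"]) (auto intro: comm_gen_c span_base)

lemma comm_M_e: "f \<in> M \<Longrightarrow> commutator f e = 0"
  using span_commutator[of G "{e}" "{0}" f e] comm_gen_e by (auto intro: span_base)

lemma e_comm: "x \<odot> e = e \<odot> x" and e_nuc: "associator e x y = 0"
  using central_mod(1)[OF zero_ideal e_M, of x] central_mod(2)[OF zero_ideal e_M, of x y]
    comm_M_e commutator_swap[of e]
  by (auto simp: commutator_def)

lemma e_nuc': "associator x e y = 0" "associator x y e = 0"
  using M_cycle[OF e_M, of x y] M_swap_left[OF e_M, of x y] by (simp_all add: e_nuc)

lemma e_slide: "e \<odot> x \<odot> y = e \<odot> (x \<odot> y)" "x \<odot> (e \<odot> y) = e \<odot> (x \<odot> y)"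
  using e_nuc[of x y] e_nuc[of x y] e_nuc'(1)[of x y] e_comm[of x] by (simp_all add: associator_def)

text \<open>As \<open>e\<close> is central and associates with everything, its multiples already
  form the ideal generated by \<open>e\<close>.\<close>

definition E :: "'b set" where "E = range (mult e)"

text \<open>The ideal generated by \<open>c\<close> and \<open>e\<close>: the sum is closed under
  multiplication because modulo \<open>E\<close> the algebra is associative and \<open>c\<close> is
  central.\<close>

definition C :: "'b set" where "C = {c \<odot> x + e \<odot> y | x y. True}"

lemma E_ideal: "two_sided_ideal E"
  unfolding two_sided_ideal_def
proof (intro conjI allI ballI)
  show "subspace E"
    unfolding subspace_def E_def
    by (auto simp: image_iff mult_add_right[symmetric] mult_scale_right[symmetric])
      (metis mult_zero_right)
  show "x \<odot> y \<in> E" "y \<odot> x \<in> E" if "y \<in> E" for x y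
    using that by (auto simp: E_def e_slide)
qed

lemma span_e_subset: "span {e} \<subseteq> E"
  using E_ideal unit_right[of e]
  by (intro span_minimal) (auto simp: E_def image_iff two_sided_ideal_def intro: exI[of _ unit])

lemma comm_c_E: "commutator x c \<in> E"
proof (rule central_mod(1)[OF E_ideal c_M])
  show "commutator c f \<in> E" if "f \<in> M" for f
    unfolding commutator_swap[of c f]
    by (intro subspace_neg two_sided_idealD(1)[OF E_ideal] subsetD[OF span_e_subset] comm_M_c that)
qed

lemma comm_comm_M:
  assumes "f \<in> M" "g \<in> M" "h \<in> M"
  shows "commutator (commutator f g) h \<in> span {e}"
proof (rule span_commutator[of "{c,e}" G])
  show "commutator x h \<in> span {e}" if "x \<in> {c, e}" "h \<in> G" for x h
    unfolding commutator_swap[of x h]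
    using that comm_gen_c comm_gen_e by (intro span_neg) (auto simp: span_zero)
qed (use assms comm_M in auto)

text \<open>Double commutators in \<open>M\<close> are multiples of \<open>e\<close>, so
  \<open>six_associator\<close> puts \<open>(f, g, h)\<close> into \<open>E\<close> for arguments in
  \<open>M\<close>, and \<open>associative_mod\<close> extends this to all arguments.\<close>

lemma assoc_E: "associator x y z \<in> E"
proof (rule associative_mod[OF E_ideal])
  fix f g h assume *: "f \<in> M" "g \<in> M" "h \<in> M"
  have "6 *s associator f g h \<in> span {e}"
    unfolding six_associator[OF *(1,2)]
    unfolding commutator_swap[of h "commutator f g"]
    by (intro span_diff span_neg comm_comm_M *)
  then show "associator f g h \<in> E"
    using span_e_subset two_sided_idealD(1)[OF E_ideal]
    by (blast intro: subspace_cancel[OF _ _ six_neq_0])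
qed

lemma E_subset_C: "E \<subseteq> C"
  unfolding E_def C_def using mult_zero_right[of c] by (metis (mono_tags, lifting) add_0 image_subsetI mem_Collect_eq)

lemma subspace_C: "subspace C"
  unfolding subspace_def
proof (intro conjI ballI allI)
  show "0 \<in> C" unfolding C_def by (auto intro!: exI[of _ 0])
  show "x + y \<in> C" if xy: "x \<in> C" "y \<in> C" for x y
  proof -
    obtain x1 x2 y1 y2 where "x = c \<odot> x1 + e \<odot> x2" "y = c \<odot> y1 + e \<odot> y2"
      using xy by (auto simp: C_def)
    then have "x + y = c \<odot> (x1 + y1) + e \<odot> (x2 + y2)" by (simp add: mult_add_right)
    then show ?thesis unfolding C_def by blast
  qed
  show "r *s x \<in> C" if x: "x \<in> C" for r x
  proof -
    obtain x1 x2 where "x = c \<odot> x1 + e \<odot> x2"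
      using x by (auto simp: C_def)
    then have "r *s x = c \<odot> (r *s x1) + e \<odot> (r *s x2)"
      by (simp add: scale_right_distrib mult_scale_right)
    then show ?thesis unfolding C_def by blast
  qed
qed

lemma c_mult_C: "c \<odot> x \<in> C"
  unfolding C_def using mult_zero_right[of e] by (metis (mono_tags, lifting) add.right_neutral mem_Collect_eq)

lemma C_ideal: "two_sided_ideal C"
  unfolding two_sided_ideal_def
proof (intro conjI allI ballI subspace_C)
  note sE = two_sided_idealD[OF E_ideal]
  have eE: "e \<odot> x \<in> E" for x by (simp add: E_def)
  fix z w assume "w \<in> C"
  then obtain x y where w: "w = c \<odot> x + e \<odot> y" by (auto simp: C_def)
  have "w \<odot> z = c \<odot> (x \<odot> z) + (associator c x z + e \<odot> y \<odot> z)"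
    unfolding w by (simp add: mult_distribs associator_def)
  moreover have "associator c x z + e \<odot> y \<odot> z \<in> E"
    by (intro subspace_add sE assoc_E eE)
  ultimately show "w \<odot> z \<in> C"
    using E_subset_C by (metis c_mult_C subsetD subspace_C subspace_add)
  have "z \<odot> w = c \<odot> (z \<odot> x) + (associator c z x + commutator z c \<odot> x - associator z c x + z \<odot> (e \<odot> y))"
    unfolding w by (simp add: mult_distribs associator_def commutator_def algebra_simps)
  moreover have "associator c z x + commutator z c \<odot> x - associator z c x + z \<odot> (e \<odot> y) \<in> E"
    by (intro subspace_add subspace_diff sE assoc_E comm_c_E eE)
  ultimately show "z \<odot> w \<in> C"
    using E_subset_C by (metis c_mult_C subsetD subspace_C subspace_add)
qed

lemma span_ce_subset: "span {c, e} \<subseteq> C"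
proof (rule span_minimal[OF _ subspace_C])
  show "{c, e} \<subseteq> C"
    using c_mult_C[of unit] span_e_subset E_subset_C by (auto simp: unit_right intro: span_base)
qed

text \<open>Elements of \<open>M\<close> are central modulo \<open>C\<close> by
  \<open>central_mod\<close>; the induction on \<open>x\<close> then only adds associators, which
  lie in \<open>E\<close>. The quotient by \<open>C\<close> is thus commutative and
  associative.\<close>

lemma comm_C: "commutator x y \<in> C"
proof -
  have M: "commutator x f \<in> C" if "f \<in> M" for f x
    by (rule central_mod(1)[OF C_ideal that]) (use that comm_M span_ce_subset in auto)
  note sC = two_sided_idealD[OF C_ideal]
  show ?thesis
  proof (induction x rule: right_normed_induct)
    case 1
    show ?case by (intro subspace_preimage commutator_add commutator_scale sC)
  next
    case 2
    show ?case using subspace_0[OF sC(1)] by simp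
  next
    case (3 f x)
    have "commutator (f \<odot> x) y = f \<odot> commutator x y - commutator y f \<odot> x
      + associator f x y + associator y f x - associator f y x"
      by (simp add: mult_distribs associator_def commutator_def algebra_simps)
    also have "\<dots> \<in> C"
      by (intro subspace_add subspace_diff sC(1) sC(2)[where x=f] sC(3)[where x=x] 3 M
          subsetD[OF E_subset_C assoc_E])
    finally show ?case .
  qed
qed

section \<open>The ideal \<open>E\<close> as a module over the quotient by \<open>C\<close>\<close>

lemma C_E:
  assumes "w \<in> C" "v \<in> E"
  shows "w \<odot> v = 0" "v \<odot> w = 0"
proof -
  obtain x y where w: "w = c \<odot> x + e \<odot> y" using assms by (auto simp: C_def)
  \<comment> \<open>The relations \<open>c e = 0\<close> and \<open>e e = 0\<close> enter here: they
    make the central element \<open>e\<close> annihilate \<open>C\<close>.\<close>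
  have "e \<odot> w = 0"
    using e_slide(1)[of c x] e_slide(1)[of e y] e_comm[of c]
    by (simp add: w mult_distribs ce ee)
  moreover obtain u where "v = e \<odot> u" using assms by (auto simp: E_def)
  ultimately show "w \<odot> v = 0" "v \<odot> w = 0"
    using e_slide e_comm by (metis mult_zero_left mult_zero_right)+
qed

lemma e_E: "e \<in> E"
  using span_e_subset by (auto intro: span_base)

text \<open>For \<open>w = e u\<close> the difference is \<open>e [u, x]\<close>, which is zero
  because \<open>e\<close> annihilates \<open>C\<close> and \<open>C\<close> contains all
  commutators.\<close>

lemma E_mult_comm: "w \<in> E \<Longrightarrow> w \<odot> x = x \<odot> w"
proof -
  assume "w \<in> E"
  then obtain u where w: "w = e \<odot> u" by (auto simp: E_def)
  have "e \<odot> commutator u x = 0"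
    by (rule C_E(2)[OF comm_C e_E])
  then show ?thesis by (simp add: w e_slide commutator_def mult_distribs)
qed

lemma E_mult_slide: "w \<in> E \<Longrightarrow> x \<odot> (y \<odot> w) = (x \<odot> y) \<odot> w"
proof -
  assume "w \<in> E"
  then obtain u where w: "w = e \<odot> u" by (auto simp: E_def)
  have "e \<odot> associator x y u = 0"
    using assoc_E E_subset_C by (intro C_E(2)[OF _ e_E]) blast
  then show ?thesis by (simp add: w e_slide associator_def mult_distribs)
qed

lemma E_mult_left_comm: "w \<in> E \<Longrightarrow> x \<odot> (y \<odot> w) = y \<odot> (x \<odot> w)"
  using E_mult_slide[of w x y] E_mult_slide[of w y x] C_E(1)[of "commutator x y" w] comm_C
  by (simp add: commutator_def mult_distribs)

section \<open>Vanishing of associators with an argument in \<open>C\<close>\<close>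

lemma assoc_c_M: "f \<in> M \<Longrightarrow> associator c f x = 0"
proof -
  assume f: "f \<in> M"
  have "commutator (commutator x c) f = 0"
    using E_mult_comm[OF comm_c_E, of x f] by (simp add: commutator_def)
  \<comment> \<open>Here \<open>[x, f]\<close> has the form \<open>c y + e z\<close>. The part
    \<open>e z\<close> commutes with \<open>c\<close>, and \<open>[c y, c] = c [y, c]\<close> is a
    product of \<open>C\<close> with \<open>E\<close>.\<close>
  moreover have "commutator (commutator x f) c = 0"
  proof -
    obtain y z where w: "commutator x f = c \<odot> y + e \<odot> z"
      using comm_C[of x f] by (auto simp: C_def)
    have "commutator (e \<odot> z) c = 0"
      using E_mult_comm[of "e \<odot> z" c] by (simp add: commutator_def E_def)
    moreover have "associator c c y = 0"
      using M_swap_left[OF c_M, of c y] subspace_cancel[of "{0}" 2 "associator c c y", OF _ _ two_neq_0]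
      by (simp add: scale_2 subspace_0 eq_neg_iff_add_eq_0)
    moreover have "c \<odot> commutator y c = 0"
      using C_E(1)[OF _ comm_c_E, of c y] c_mult_C[of unit] by (simp add: unit_right)
    ultimately show ?thesis
      by (simp add: w commutator_add commutator_mult[OF c_M])
  qed
  moreover have "commutator x (commutator c f) = 0"
  proof -
    have "commutator c f \<in> E"
      unfolding commutator_swap[of c f]
      by (intro subspace_neg two_sided_idealD(1)[OF E_ideal] subsetD[OF span_e_subset] comm_M_c f)
    then show ?thesis
      using E_mult_comm[of "commutator c f" x] by (simp add: commutator_def)
  qed
  ultimately have "6 *s associator c f x = 0"
    by (simp add: six_associator[OF c_M f])
  then show ?thesis using six_neq_0 by simp
qed

text \<open>An instance of \<open>nucleus_mod\<close> with the zero ideal and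
  \<open>Z = span {c, e}\<close>, which contains all commutators of \<open>M\<close>.\<close>

lemma c_nuc: "associator c x y = 0" "associator x c y = 0" "associator x y c = 0"
proof -
  have "associator c x y \<in> {0}"
  proof (rule nucleus_mod[OF zero_ideal, of "span {c, e}"])
    show "span {c, e} \<subseteq> M" using c_M e_M by (intro span_minimal) auto
    then show "commutator z f \<in> span {c, e}" if "z \<in> span {c, e}" "f \<in> M" for z f
      using that by (intro comm_M) auto
    show "associator z f x \<in> {0}" if "z \<in> span {c, e}" "f \<in> M" for z f x
      using that(1)
    proof (induction rule: span_induct)
      case base
      show ?case by (intro subspace_preimage associator_add associator_scale) simp
    next
      case (step z)
      then show ?case using assoc_c_M[OF that(2)] e_nuc by auto
    qed
  qed (auto intro: span_base)
  then show "associator c x y = 0" "associator x c y = 0" "associator x y c = 0"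
    using M_cycle[OF c_M, of x y] M_swap_left[OF c_M, of x y] by simp_all
qed

lemma c_E: "w \<in> E \<Longrightarrow> c \<odot> w = 0"
  using C_E(1)[of c w] c_mult_C[of unit] by (simp add: unit_right)

lemma E_assoc:
  assumes "w \<in> E"
  shows "associator w x y = 0" "associator x w y = 0" "associator x y w = 0"
proof -
  obtain u where w: "w = e \<odot> u" using assms by (auto simp: E_def)
  have "e \<odot> associator p q r = 0" for p q r
    using assoc_E E_subset_C by (intro C_E(2)[OF _ e_E]) blast
  then show "associator w x y = 0" "associator x w y = 0" "associator x y w = 0"
    by (simp_all add: w e_slide associator_def mult_distribs)
qed

text \<open>By \<open>teichmuller\<close>, \<open>(c u, x, y) = c (u, x, y)\<close>, a product of
  \<open>C\<close> with \<open>E\<close>; in the other positions \<open>c\<close> is moved to the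
  left, commuting up to \<open>E\<close>. Hence associators depend on their arguments only modulo
  \<open>C\<close>.\<close>

lemma C_assoc:
  assumes "w \<in> C"
  shows "associator w x y = 0" "associator x w y = 0" "associator x y w = 0"
proof -
  obtain u v where w: "w = c \<odot> u + e \<odot> v" using assms by (auto simp: C_def)
  have ev: "e \<odot> v \<in> E" by (simp add: E_def)
  have 1: "associator (c \<odot> u) x y = 0" for u x y
    using teichmuller[of c u x y] by (simp add: c_nuc c_E assoc_E)
  have 2: "associator x (c \<odot> u) y = 0" for u x y
  proof -
    have "associator (x \<odot> c) u y = associator (c \<odot> x) u y + associator (commutator x c) u y"
      by (simp add: commutator_def associator_diff)
    then show ?thesis
      using teichmuller[of x c u y] by (simp add: c_nuc 1 E_assoc comm_c_E)
  qed
  have 3: "associator x y (c \<odot> u) = 0" for u x y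
  proof -
    have "associator x (y \<odot> c) u = associator x (c \<odot> y) u + associator x (commutator y c) u"
      by (simp add: commutator_def associator_diff)
    then show ?thesis
      using teichmuller[of x y c u] by (simp add: c_nuc 2 E_assoc comm_c_E)
  qed
  show "associator w x y = 0" "associator x w y = 0" "associator x y w = 0"
    by (simp_all add: w associator_add 1 2 3 E_assoc[OF ev])
qed

lemma associator_comm: "associator x y (z \<odot> w) = associator x y (w \<odot> z)"
    "associator x (z \<odot> w) y = associator x (w \<odot> z) y"
  using C_assoc[OF comm_C[of z w]] by (simp_all add: commutator_def associator_diff)

section \<open>Derivation rules for associators\<close>

lemma M_M_derivation_gen:
  assumes f: "f \<in> M" and g: "g \<in> M" and h: "h \<in> M"
  shows "associator f g (h \<odot> y) = h \<odot> associator f g y + y \<odot> associator f g h"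
proof -
  have E0: "commutator (associator p q r) s = 0" for p q r s
    using E_mult_comm[OF assoc_E] by (simp add: commutator_def)
  have C: "commutator f g \<in> C" for f g by (rule comm_C)
  \<comment> \<open>The defect in \<open>six_associator_mult\<close> vanishes: commutators lie in
    \<open>C\<close>, so associators kill them, and associators lie in \<open>E\<close>, so they
    commute with everything.\<close>
  have "6 *s associator f g (h \<odot> y) = h \<odot> (6 *s associator f g y) + (6 *s associator f g h) \<odot> y"
    by (simp add: six_associator_mult[OF f g h] C_assoc[OF C] E0)
  also have "\<dots> = 6 *s (h \<odot> associator f g y + y \<odot> associator f g h)"
    by (simp add: mult_scale_left mult_scale_right scale_right_distrib E_mult_comm[OF assoc_E, of f g h y])
  finally show ?thesis using six_neq_0 by simp
qed

text \<open>The previous rule peels off the first letter of a word. Rebracketing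
  \<open>(h x) y\<close> costs \<open>(h, x, y)\<close>, which lies in \<open>E\<close> and is
  killed by associators.\<close>

lemma M_M_derivation:
  assumes f: "f \<in> M" and g: "g \<in> M"
  shows "associator f g (x \<odot> y) = x \<odot> associator f g y + y \<odot> associator f g x"
proof (induction x arbitrary: y rule: right_normed_induct)
  case 1
  show ?case
    by (auto simp: subspace_def associator_add associator_scale mult_distribs mult_scale_left
        mult_scale_right scale_right_distrib)
next
  case 2
  show ?case by (simp add: unit_left)
next
  case (3 h x)
  have "associator f g (h \<odot> x \<odot> y) = associator f g (h \<odot> (x \<odot> y)) + associator f g (associator h x y)"
    by (simp add: associator_def[of h x y] associator_diff)
  also have "\<dots> = h \<odot> (x \<odot> associator f g y + y \<odot> associator f g x) + (x \<odot> y) \<odot> associator f g h"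
    by (simp add: E_assoc(3)[OF assoc_E] M_M_derivation_gen[OF f g 3(1)] 3(2))
  also have "\<dots> = (h \<odot> x) \<odot> associator f g y + y \<odot> (h \<odot> associator f g x + x \<odot> associator f g h)"
    using E_mult_slide[OF assoc_E, of h x f g y] E_mult_left_comm[OF assoc_E, of h y f g x]
      E_mult_slide[OF assoc_E, of x y f g h] E_mult_left_comm[OF assoc_E, of x y f g h]
    by (simp add: mult_add_right)
  finally show ?case
    by (simp add: M_M_derivation_gen[OF f g 3(1)])
qed

text \<open>The assumption on \<open>x\<close> is the induction hypothesis of
  \<open>M_derivation_right\<close>. It makes the terms of \<open>associator_mult_middle\<close>
  cancel down to a Leibniz rule.\<close>

lemma left_step:
  assumes f: "f \<in> M" and g: "g \<in> M"
    and x: "\<And>y z. associator f x (y \<odot> z) = y \<odot> associator f x z + z \<odot> associator f x y"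
  shows "associator f (g \<odot> x) y = x \<odot> associator f g y + g \<odot> associator f x y"
proof -
  have "associator f (g \<odot> x) y = associator f g (x \<odot> y) - associator f x (g \<odot> y)
      + 2 *s (g \<odot> associator f x y) - 2 *s (y \<odot> associator f g x)"
    unfolding associator_mult_middle[OF f g] associator_comm(1)[of f x y g]
    by (simp add: C_assoc[OF comm_C] scale_2 E_mult_comm[OF assoc_E, of _ _ _ g]
        E_mult_comm[OF assoc_E, of _ _ _ y])
  then show ?thesis
    unfolding M_M_derivation[OF f g] x M_swap[OF f g] by (simp add: scale_2)
qed

text \<open>By \<open>left_step\<close>, \<open>(f, g x, _)\<close> is a combination of
  \<open>(f, g, _)\<close> and \<open>(f, x, _)\<close>, both derivations.\<close>

lemma M_derivation_right:
  assumes "f \<in> M"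
  shows "associator f x (y \<odot> z) = y \<odot> associator f x z + z \<odot> associator f x y"
proof (induction x arbitrary: y z rule: right_normed_induct)
  case 1
  show ?case
    by (auto simp: subspace_def associator_add associator_scale mult_distribs mult_scale_left
        mult_scale_right scale_right_distrib)
next
  case 2
  show ?case by simp
next
  case (3 g x)
  show ?case
    unfolding left_step[OF assms 3(1) 3(2)] M_M_derivation[OF assms 3(1)] 3(2)
    by (simp add: mult_distribs E_mult_left_comm[OF assoc_E, of x] E_mult_left_comm[OF assoc_E, of g] algebra_simps)
qed

lemmas M_left_step = left_step[OF _ _ M_derivation_right]

text \<open>Both sides obey the Leibniz rule on \<open>g x\<close>, and \<open>M_swap\<close>
  settles the argument \<open>g\<close> in \<open>M\<close>.\<close>

lemma M_skew:
  assumes "f \<in> M"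
  shows "associator f y x = - associator f x y"
proof (induction x rule: right_normed_induct)
  case 1
  show ?case
    by (auto simp: subspace_def associator_add associator_scale)
next
  case 2
  show ?case by simp
next
  case (3 g x)
  then show ?case
    by (simp add: M_left_step[OF assms 3(1) assms] M_derivation_right[OF assms] M_swap[OF assms])
qed

lemma M_derivation_middle:
  assumes "f \<in> M"
  shows "associator f (x \<odot> y) z = x \<odot> associator f y z + y \<odot> associator f x z"
  using M_skew[OF assms, of "x \<odot> y" z] M_skew[OF assms, of x z] M_skew[OF assms, of y z]
    M_derivation_right[OF assms, of z x y]
  by simp

lemma left_mult_derivation:
  assumes "f \<in> M"
  shows "associator (f \<odot> x) y z = f \<odot> associator x y z + x \<odot> associator f y z"
  using teichmuller[of f x y z]
  by (simp add: M_derivation_middle[OF assms] M_derivation_right[OF assms]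
      E_mult_comm[OF assoc_E, of _ _ _ z] algebra_simps)

text \<open>Attached to a single element, so that one induction on right-normed words yields it for
  all. The clauses are bundled because the first two for \<open>f x\<close> use the derivation rule
  for \<open>x\<close>.\<close>

definition skew_derivation :: "'b \<Rightarrow> bool" where
  "skew_derivation x \<longleftrightarrow> (\<forall>y z. associator y x z = - associator x y z \<and> associator y z x = associator x y z
    \<and> associator x z y = - associator x y z
    \<and> (\<forall>w. associator x y (z \<odot> w) = z \<odot> associator x y w + w \<odot> associator x y z))"

lemma skew_derivation: "skew_derivation x"
proof (induction x rule: right_normed_induct)
  case 1
  show ?case
    unfolding skew_derivation_def
    by (intro subspace_All subspace_conj subspace_eq)
      (simp_all add: associator_add associator_scale mult_add_right mult_scale_right scale_right_distrib)
next
  case 2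
  show ?case by (simp add: skew_derivation_def)
next
  case (3 f x)
  note f = 3(1)
  have x: "associator y x z = - associator x y z" "associator y z x = associator x y z"
      "associator x z y = - associator x y z"
      "associator x y (z \<odot> w) = z \<odot> associator x y w + w \<odot> associator x y z" for y z w
    using 3(2) unfolding skew_derivation_def by blast+
  have fyf: "associator y f z = - associator f y z" "associator y z f = associator f y z"
    for y z using M_swap_left[OF f] M_cycle[OF f] by auto
  note comm = E_mult_comm[OF assoc_E]
  have "associator y (f \<odot> x) z = - associator (f \<odot> x) y z" for y z
  proof -
    \<comment> \<open>With \<open>teichmuller\<close> for \<open>y, f, x, z\<close>, every
      associator has a bare \<open>f\<close> or \<open>x\<close> as an argument, so the known rules
      apply.\<close>
    have "associator y (f \<odot> x) z = associator (y \<odot> f) x z + associator y f (x \<odot> z)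
      - y \<odot> associator f x z - associator y f x \<odot> z"
      using teichmuller[of y f x z] by (simp add: algebra_simps)
    also have "associator (y \<odot> f) x z = - associator x (y \<odot> f) z"
      using x(1)[of "y \<odot> f" z] by simp
    also have "\<dots> = associator x z (y \<odot> f)"
      using x(3)[of "y \<odot> f" z] by simp
    also have "\<dots> = y \<odot> associator x z f + f \<odot> associator x z y"
      by (rule x(4))
    also have "associator x z f = associator f x z" by (rule fyf(2))
    also have "associator x z y = - associator x y z" by (rule x(3))
    also have "associator y f (x \<odot> z) = - (x \<odot> associator f y z + z \<odot> associator f y x)"
      by (simp add: fyf M_derivation_right[OF f])
    also have "associator y f x = - associator f y x" by (rule fyf)
    finally show ?thesis
      by (simp add: left_mult_derivation[OF f] comm)
  qed
  moreover have "associator y z (f \<odot> x) = associator (f \<odot> x) y z" for y z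
  proof -
    have "associator y z (f \<odot> x) = y \<odot> associator z f x + associator y z f \<odot> x
      + associator y (z \<odot> f) x - associator (y \<odot> z) f x"
      using teichmuller[of y z f x] by (simp add: algebra_simps)
    also have "associator z f x = - associator f z x" by (rule fyf)
    also have "associator y z f = associator f y z" by (rule fyf)
    also have "associator y (z \<odot> f) x = z \<odot> associator x y f + f \<odot> associator x y z"
      unfolding x(2) by (rule x(4))
    also have "associator x y f = - associator f y x"
      unfolding fyf by (rule M_skew[OF f])
    also have "associator (y \<odot> z) f x = - (y \<odot> associator f z x + z \<odot> associator f y x)"
      by (simp add: fyf M_derivation_middle[OF f])
    finally show ?thesis
      by (simp add: left_mult_derivation[OF f] comm)
  qed
  moreover have "associator (f \<odot> x) z y = - associator (f \<odot> x) y z" for y z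
    by (simp add: left_mult_derivation[OF f] x(3)[of z y] M_skew[OF f, of z y])
  moreover have "associator (f \<odot> x) y (z \<odot> w) = z \<odot> associator (f \<odot> x) y w + w \<odot> associator (f \<odot> x) y z" for y z w
    by (simp add: left_mult_derivation[OF f] M_derivation_right[OF f] x(4) mult_add_right
        E_mult_left_comm[OF assoc_E, of f] E_mult_left_comm[OF assoc_E, of x])
  ultimately show ?case unfolding skew_derivation_def by blast
qed

lemma alternative: "associator x x y = 0" "associator y x x = 0"
proof -
  have *: "associator x x y = - associator x x y" "associator y x x = associator x y x"
     "associator x y x = - associator x x y"
    using skew_derivation[of x] unfolding skew_derivation_def by blast+
  have "2 *s associator x x y = 0"
    using *(1) by (simp add: scale_2 eq_neg_iff_add_eq_0)
  then show "associator x x y = 0" using two_neq_0 by simp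
  then show "associator y x x = 0" using * by simp
qed

end

section \<open>The enveloping algebra and its quotient\<close>

lemma env_rel_relator: "r \<in> env_relators \<Longrightarrow> env_rel r 0"
  by (simp add: env_rel_def env_ideal_def free.ideal_generated_def hull_inc)

lemma env_gen_swap_left:
  "env.associator (env_gen i) x y + env.associator x (env_gen i) y = 0"
  unfolding env.associator_def
proof (transfer fixing: i)
  fix x y :: "(mbasis, 'a) free_nonassoc"
  show "env_rel (free_gen i \<bullet> x \<bullet> y - free_gen i \<bullet> (x \<bullet> y) + (x \<bullet> free_gen i \<bullet> y - x \<bullet> (free_gen i \<bullet> y))) 0"
    unfolding free.associator_def[symmetric] malcev_to_free_basis[symmetric]
    unfolding env_relators_def by (rule env_rel_relator[unfolded env_relators_def]) blast
qed

lemma env_gen_swap_right: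
  "env.associator x (env_gen i) y + env.associator x y (env_gen i) = 0"
  unfolding env.associator_def
proof (transfer fixing: i)
  fix x y :: "(mbasis, 'a) free_nonassoc"
  show "env_rel (x \<bullet> free_gen i \<bullet> y - x \<bullet> (free_gen i \<bullet> y) + (x \<bullet> y \<bullet> free_gen i - x \<bullet> (y \<bullet> free_gen i))) 0"
    unfolding free.associator_def[symmetric] malcev_to_free_basis[symmetric]
    unfolding env_relators_def by (rule env_rel_relator[unfolded env_relators_def]) blast
qed

lemma env_commutator:
  "env.commutator (env_gen i) (env_gen j) = abs_malcev_env (malcev_to_free (basis_bracket i j))"
proof -
  have br: "bracket (Poly_Mapping.single i 1) (Poly_Mapping.single j 1) = basis_bracket i j"
    by (simp add: bracket_def pm_bilinear_def)
  have "env_rel (free_gen i \<bullet> free_gen j - free_gen j \<bullet> free_gen i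
      - malcev_to_free (basis_bracket i j :: 'a malcev)) 0"
    unfolding br[symmetric] malcev_to_free_basis[symmetric]
    unfolding env_relators_def by (rule env_rel_relator[unfolded env_relators_def]) blast
  then have "env_rel (free_gen i \<bullet> free_gen j - free_gen j \<bullet> free_gen i)
      (malcev_to_free (basis_bracket i j :: 'a malcev))"
    by (simp add: env_rel_def)
  then show ?thesis
    unfolding env.commutator_def env_gen.abs_eq times_malcev_env.abs_eq minus_malcev_env.abs_eq
    by (simp add: malcev_env.abs_eq_iff)
qed

lemma malcev_to_free_zero: "malcev_to_free 0 = 0"
  by (simp add: malcev_to_free_def)

lemma malcev_to_free_minus_basis: "malcev_to_free (- Poly_Mapping.single i 1) = - free_gen i"
  by (simp add: malcev_to_free_def)

lemma env_commutator_cases: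
  "env.commutator (env_gen i) (env_gen j) =
    (if i = m\<^sub>a \<and> j = m\<^sub>b then env_gen m\<^sub>c else if i = m\<^sub>b \<and> j = m\<^sub>a then - env_gen m\<^sub>c
     else if i = m\<^sub>c \<and> j = m\<^sub>d then env_gen m\<^sub>e else if i = m\<^sub>d \<and> j = m\<^sub>c then - env_gen m\<^sub>e else 0)"
  unfolding env_commutator
  by (cases i; cases j)
    (simp_all add: malcev_to_free_zero malcev_to_free_minus_basis malcev_to_free_basis
      env_gen.abs_eq uminus_malcev_env.abs_eq zero_malcev_env_def)

text \<open>The preimage of \<open>S\<close> in the free algebra is a subspace that contains every
  monomial, by induction on the magma.\<close>

lemma env_gen_induct:
  assumes S: "env.subspace S" "1 \<in> S" "range env_gen \<subseteq> S" "\<And>x y. x \<in> S \<Longrightarrow> y \<in> S \<Longrightarrow> x * y \<in> S"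
  shows "x \<in> S"
proof -
  have mono: "abs_malcev_env (Poly_Mapping.single (Some t) 1) \<in> S" for t
  proof (induction t)
    case (Gen i)
    then show ?case using S(3) by (auto simp: env_gen.abs_eq free_gen_def)
  next
    case (Mul u v)
    have "Poly_Mapping.single (Some (Mul u v)) 1
        = Poly_Mapping.single (Some u) (1::'a) \<bullet> Poly_Mapping.single (Some v) 1"
      by (simp add: free_mult_def pm_bilinear_def)
    then show ?case using S(4)[OF Mul] by (simp add: times_malcev_env.abs_eq)
  qed
  have mono: "abs_malcev_env (Poly_Mapping.single m 1) \<in> S" for m
    using S(2) mono by (cases m) (auto simp: one_malcev_env_def free_one_def)
  have sub: "pm.subspace {u. abs_malcev_env u \<in> S}"
    unfolding pm.subspace_def
    using env.subspace_0[OF S(1)] env.subspace_add[OF S(1)] env.subspace_scale[OF S(1)]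
    by (auto simp: zero_malcev_env_def plus_malcev_env.abs_eq[symmetric] env_scale.abs_eq[symmetric])
  have "u \<in> {u. abs_malcev_env u \<in> S}" for u
  proof -
    have "(\<Sum>i\<in>Poly_Mapping.keys u. pm_scale (Poly_Mapping.lookup u i) (Poly_Mapping.single i 1))
        \<in> {u. abs_malcev_env u \<in> S}"
      using mono by (intro pm.subspace_sum[OF sub] pm.subspace_scale[OF sub]) simp
    then show ?thesis by (simp add: sum_pm_scale_single)
  qed
  then show ?thesis by (induction x rule: malcev_env.abs_induct) auto
qed

text \<open>A characteristic dividing the prime 2 or 3 would equal it, because it is never
  1.\<close>

lemma numeral_neq_0:
  assumes "CHAR('k::field) \<noteq> 2" and "CHAR('k) \<noteq> 3"
  shows "(2::'k) \<noteq> 0" "(3::'k) \<noteq> 0"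
proof -
  have "\<not> CHAR('k) dvd 2" "\<not> CHAR('k) dvd 3"
    using assms CHAR_not_1'[where 'a='k] dvd_imp_le[of "CHAR('k)" 2] dvd_imp_le[of "CHAR('k)" 3]
    by (auto simp: le_Suc_eq numeral_eq_Suc)
  then show "(2::'k) \<noteq> 0" "(3::'k) \<noteq> 0"
    using of_nat_eq_0_iff_char_dvd[of 2, where 'a='k] of_nat_eq_0_iff_char_dvd[of 3, where 'a='k]
    by simp_all
qed

lemma alt_generated_env:
  assumes "CHAR('k::field) \<noteq> 2" and "CHAR('k) \<noteq> 3"
  shows "alt_generated (env_scale :: 'k \<Rightarrow> _) (*) 1 (range env_gen)"
proof (intro alt_generated.intro alt_generated_axioms.intro env.nonassoc_algebra_axioms
    numeral_neq_0[OF assms])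
  fix f g :: "'k malcev_env" assume "f \<in> range env_gen" "g \<in> range env_gen"
  then show "env.commutator f g \<in> env.span (range env_gen)"
    by (auto simp: env_commutator_cases env.span_zero env.span_base env.span_neg)
next
  fix f x y :: "'k malcev_env" assume "f \<in> range env_gen"
  then show "env.associator f x y + env.associator x f y = 0"
    "env.associator x f y + env.associator x y f = 0"
    using env_gen_swap_left env_gen_swap_right by auto
qed (rule env_gen_induct)

section \<open>The quotient by the ideal of \<open>c e\<close> and \<open>e e\<close>\<close>

definition ce_ideal :: "'k::field malcev_env set" where
  "ce_ideal = env.ideal_generated {env_gen m\<^sub>c * env_gen m\<^sub>e, env_gen m\<^sub>e * env_gen m\<^sub>e}"

lemma ce_ideal: "env.two_sided_ideal ce_ideal"
  unfolding ce_ideal_def by (rule env.two_sided_ideal_ideal_generated)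

lemmas ce_ideal_subspace = env.two_sided_idealD(1)[OF ce_ideal]
  and ce_ideal_mult = env.two_sided_idealD(2,3)[OF ce_ideal]

text \<open>The quotient is formed as a type because \<open>nonassoc_algebra\<close> describes
  operations on a whole type.\<close>

definition ce_rel :: "'k::field malcev_env \<Rightarrow> 'k malcev_env \<Rightarrow> bool" where
  "ce_rel x y \<longleftrightarrow> x - y \<in> ce_ideal"

lemma equivp_ce_rel: "equivp (ce_rel :: 'k::field malcev_env \<Rightarrow> _)" (is "equivp ?r")
proof (rule equivpI)
  show "reflp ?r"
    by (rule reflpI) (simp add: ce_rel_def env.subspace_0[OF ce_ideal_subspace])
  show "symp ?r"
    by (rule sympI) (metis ce_rel_def minus_diff_eq env.subspace_neg[OF ce_ideal_subspace])
  show "transp ?r"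
  proof (rule transpI)
    fix x y z :: "'k malcev_env"
    assume "ce_rel x y" "ce_rel y z"
    then have "(x - y) + (y - z) \<in> ce_ideal"
      unfolding ce_rel_def by (rule env.subspace_add[OF ce_ideal_subspace])
    then show "?r x z" unfolding ce_rel_def by simp
  qed
qed

quotient_type (overloaded) 'k ce_quotient = "'k::field malcev_env" / ce_rel
  by (rule equivp_ce_rel)

lift_definition ce_scale :: "'k::field \<Rightarrow> 'k ce_quotient \<Rightarrow> 'k ce_quotient" is env_scale
  unfolding ce_rel_def
  by (metis env.scale_right_diff_distrib env.subspace_scale[OF ce_ideal_subspace])

lift_definition ce_mult :: "'k::field ce_quotient \<Rightarrow> 'k ce_quotient \<Rightarrow> 'k ce_quotient" is "(*)"
proof -
  fix x x' y y' :: "'k malcev_env"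
  assume "ce_rel x x'" "ce_rel y y'"
  then have "(x - x') * y + x' * (y - y') \<in> ce_ideal"
    unfolding ce_rel_def by (intro env.subspace_add[OF ce_ideal_subspace] ce_ideal_mult)
  then show "ce_rel (x * y) (x' * y')"
    by (simp add: ce_rel_def env.mult_diff_left env.mult_diff_right)
qed

lift_definition ce_one :: "'k::field ce_quotient" is 1 .

instantiation ce_quotient :: (field) ab_group_add
begin

lift_definition zero_ce_quotient :: "'a ce_quotient" is 0 .

lift_definition plus_ce_quotient :: "'a ce_quotient \<Rightarrow> 'a ce_quotient \<Rightarrow> 'a ce_quotient" is "(+)"
  unfolding ce_rel_def by (metis add_diff_add env.subspace_add[OF ce_ideal_subspace])

lift_definition uminus_ce_quotient :: "'a ce_quotient \<Rightarrow> 'a ce_quotient" is uminus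
  unfolding ce_rel_def by (metis minus_diff_minus env.subspace_neg[OF ce_ideal_subspace])

lift_definition minus_ce_quotient :: "'a ce_quotient \<Rightarrow> 'a ce_quotient \<Rightarrow> 'a ce_quotient" is "(-)"
proof -
  fix x x' y y' :: "'a malcev_env"
  assume "ce_rel x x'" "ce_rel y y'"
  then have "(x - x') - (y - y') \<in> ce_ideal"
    unfolding ce_rel_def by (rule env.subspace_diff[OF ce_ideal_subspace])
  then show "ce_rel (x - y) (x' - y')" by (simp add: ce_rel_def algebra_simps)
qed

instance
proof
  have refl: "ce_rel u u" for u :: "'a malcev_env"
    by (rule equivp_reflp[OF equivp_ce_rel])
  fix x y z :: "'a ce_quotient"
  show "x + y + z = x + (y + z)" by transfer (simp add: add.assoc refl)
  show "x + y = y + x" by transfer (simp add: add.commute refl)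
  show "0 + x = x" by transfer (simp add: refl)
  show "- x + x = 0" by transfer (simp add: refl)
  show "x - y = x + - y" by transfer (simp add: refl)
qed

end

global_interpretation ce: nonassoc_algebra
  "ce_scale :: 'k::field \<Rightarrow> 'k ce_quotient \<Rightarrow> _" ce_mult ce_one
proof
  have refl: "ce_rel u u" for u :: "'k malcev_env"
    by (rule equivp_reflp[OF equivp_ce_rel])
  fix x y z :: "'k ce_quotient" and r s :: 'k
  show "ce_scale r (x + y) = ce_scale r x + ce_scale r y"
    by transfer (simp add: env.scale_right_distrib refl)
  show "ce_scale (r + s) x = ce_scale r x + ce_scale s x"
    by transfer (simp add: env.scale_left_distrib refl)
  show "ce_scale r (ce_scale s x) = ce_scale (r * s) x"
    by transfer (simp add: refl)
  show "ce_scale 1 x = x"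
    by transfer (simp add: refl)
  show "ce_mult (x + y) z = ce_mult x z + ce_mult y z"
    by transfer (simp add: env.mult_add_left refl)
  show "ce_mult x (y + z) = ce_mult x y + ce_mult x z"
    by transfer (simp add: env.mult_add_right refl)
  show "ce_mult (ce_scale r x) y = ce_scale r (ce_mult x y)"
    by transfer (simp add: env.mult_scale_left refl)
  show "ce_mult x (ce_scale r y) = ce_scale r (ce_mult x y)"
    by transfer (simp add: env.mult_scale_right refl)
  show "ce_mult ce_one x = x"
    by transfer (simp add: env.unit_left refl)
  show "ce_mult x ce_one = x"
    by transfer (simp add: env.unit_right refl)
qed

lemma abs_associator:
  "abs_ce_quotient (env.associator x y z)
    = ce.associator (abs_ce_quotient x) (abs_ce_quotient y) (abs_ce_quotient z)"
  by (simp add: env.associator_def ce.associator_def ce_mult.abs_eq minus_ce_quotient.abs_eq)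

lemma abs_commutator:
  "abs_ce_quotient (env.commutator x y) = ce.commutator (abs_ce_quotient x) (abs_ce_quotient y)"
  by (simp add: env.commutator_def ce.commutator_def ce_mult.abs_eq minus_ce_quotient.abs_eq)

lemma abs_eq_0_iff: "abs_ce_quotient x = 0 \<longleftrightarrow> x \<in> ce_ideal"
  by (simp add: zero_ce_quotient_def ce_quotient.abs_eq_iff ce_rel_def)

definition ce_gen :: "mbasis \<Rightarrow> 'k::field ce_quotient" where
  "ce_gen i = abs_ce_quotient (env_gen i)"

lemma ce_commutator_cases:
  "ce.commutator (ce_gen i) (ce_gen j) =
    (if i = m\<^sub>a \<and> j = m\<^sub>b then ce_gen m\<^sub>c else if i = m\<^sub>b \<and> j = m\<^sub>a then - ce_gen m\<^sub>c
     else if i = m\<^sub>c \<and> j = m\<^sub>d then ce_gen m\<^sub>e else if i = m\<^sub>d \<and> j = m\<^sub>c then - ce_gen m\<^sub>e else 0)"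
  unfolding ce_gen_def abs_commutator[symmetric] env_commutator_cases
  by (simp add: uminus_ce_quotient.abs_eq zero_ce_quotient_def)

lemma two_step_chain_ce:
  assumes "CHAR('k::field) \<noteq> 2" and "CHAR('k) \<noteq> 3"
  shows "two_step_chain (ce_scale :: 'k \<Rightarrow> _) ce_mult ce_one (range ce_gen) (ce_gen m\<^sub>c) (ce_gen m\<^sub>e)"
proof (intro two_step_chain.intro two_step_chain_axioms.intro alt_generated.intro
    alt_generated_axioms.intro ce.nonassoc_algebra_axioms numeral_neq_0[OF assms])
  fix f g x y :: "'k ce_quotient"
  have "\<exists>x'. x = abs_ce_quotient x'" for x :: "'k ce_quotient"
    by (induction x rule: ce_quotient.abs_induct) auto
  then obtain x' y' where xy: "x = abs_ce_quotient x'" "y = abs_ce_quotient y'"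
    by blast
  show "ce.associator f x y + ce.associator x f y = 0"
    "ce.associator x f y + ce.associator x y f = 0" if f: "f \<in> range ce_gen"
    using f
    by (auto simp: xy ce_gen_def abs_associator[symmetric] plus_ce_quotient.abs_eq
        env_gen_swap_left env_gen_swap_right zero_ce_quotient_def)
  show "ce.commutator f g \<in> ce.span (range ce_gen)"
    "ce.commutator f g \<in> ce.span {ce_gen m\<^sub>c, ce_gen m\<^sub>e}"
    if "f \<in> range ce_gen" "g \<in> range ce_gen"
    using that
    by (auto simp: ce_commutator_cases ce.span_zero ce.span_base ce.span_neg)
  show "ce.commutator f (ce_gen m\<^sub>c) \<in> ce.span {ce_gen m\<^sub>e}" "ce.commutator f (ce_gen m\<^sub>e) = 0"
    if "f \<in> range ce_gen"
    using that
    by (auto simp: ce_commutator_cases ce.span_zero ce.span_base ce.span_neg)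
next
  fix S :: "'k ce_quotient set" and x :: "'k ce_quotient"
  assume S: "ce.subspace S" "ce_one \<in> S" "range ce_gen \<subseteq> S" "\<And>x y. x \<in> S \<Longrightarrow> y \<in> S \<Longrightarrow> ce_mult x y \<in> S"
  have "x' \<in> {x. abs_ce_quotient x \<in> S}" for x'
  proof (rule env_gen_induct)
    show "env.subspace {x. abs_ce_quotient x \<in> S}"
      unfolding env.subspace_def
      using ce.subspace_0[OF S(1)] ce.subspace_add[OF S(1)] ce.subspace_scale[OF S(1)]
      by (auto simp: zero_ce_quotient_def plus_ce_quotient.abs_eq[symmetric] ce_scale.abs_eq[symmetric])
  qed (use S in \<open>auto simp: ce_mult.abs_eq[symmetric] ce_one.abs_eq[symmetric] ce_gen_def\<close>)
  then show "x \<in> S" by (induction x rule: ce_quotient.abs_induct) auto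
next
  show "ce_mult (ce_gen m\<^sub>c) (ce_gen m\<^sub>e) = (0 :: 'k ce_quotient)"
    "ce_mult (ce_gen m\<^sub>e) (ce_gen m\<^sub>e) = (0 :: 'k ce_quotient)"
    unfolding ce_gen_def ce_mult.abs_eq abs_eq_0_iff
    by (simp_all add: ce_ideal_def env.ideal_generated_def hull_inc)
qed auto

theorem corollary5p9:
  assumes "CHAR('k::field) \<noteq> 2" and "CHAR('k) \<noteq> 3"
  shows "(env.alternator_ideal :: 'k malcev_env set) =
    env.ideal_generated {env_gen m\<^sub>c * env_gen m\<^sub>e, env_gen m\<^sub>e * env_gen m\<^sub>e}"
proof (rule antisym)
  interpret Q: two_step_chain "ce_scale :: 'k \<Rightarrow> _" ce_mult ce_one "range ce_gen" "ce_gen m\<^sub>c" "ce_gen m\<^sub>e"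
    by (rule two_step_chain_ce[OF assms])
  \<comment> \<open>The quotient by \<open>ce_ideal\<close> is alternative, so all generators of the
    alternator ideal vanish in it.\<close>
  have "env.associator x x y \<in> ce_ideal" "env.associator y x x \<in> ce_ideal" for x y :: "'k malcev_env"
    unfolding abs_eq_0_iff[symmetric] abs_associator by (rule Q.alternative)+
  then show "(env.alternator_ideal :: 'k malcev_env set)
      \<subseteq> env.ideal_generated {env_gen m\<^sub>c * env_gen m\<^sub>e, env_gen m\<^sub>e * env_gen m\<^sub>e}"
    unfolding env.alternator_ideal_def ce_ideal_def[symmetric]
    unfolding env.ideal_generated_def by (intro hull_minimal ce_ideal) auto
next
  interpret U: alt_generated "env_scale :: 'k \<Rightarrow> _" "(*)" 1 "range env_gen"
    by (rule alt_generated_env[OF assms])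
  let ?I = "env.alternator_ideal :: 'k malcev_env set"
  let ?c = "env_gen m\<^sub>c :: 'k malcev_env" and ?d = "env_gen m\<^sub>d :: 'k malcev_env"
    and ?e = "env_gen m\<^sub>e :: 'k malcev_env"
  have I: "env.two_sided_ideal ?I"
    unfolding env.alternator_ideal_def by (rule env.two_sided_ideal_ideal_generated)
  note sI = env.two_sided_idealD[OF I]
  have gen: "env_gen i \<in> U.M" for i by (auto intro: env.span_base)
  have e_M: "env.commutator ?e f = 0" if "f \<in> U.M" for f
  proof -
    have "env.commutator ?e f \<in> {0}"
      by (rule U.span_commutator[of "{?e}" "range env_gen"])
        (use that in \<open>auto simp: env_commutator_cases env.span_base\<close>)
    then show ?thesis by simp
  qed
  \<comment> \<open>\<open>alternator_eq\<close> is normalised by \<open>[c, d] = 6 z\<close>, and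
    here \<open>[c, d] = e\<close>.\<close>
  define z where "z = env_scale (1/6) ?e"
  have e: "?e = env_scale 6 z" using U.six_neq_0 by (simp add: z_def)
  have alt: "env.associator ?d (env_gen m\<^sub>a * env_gen m\<^sub>b) (env_gen m\<^sub>a * env_gen m\<^sub>b) = - (z * ?c)"
    by (rule U.alternator_eq)
      (use gen e_M in \<open>auto simp: env_commutator_cases z_def env.commutator_scale U.six_neq_0 intro: env.span_scale\<close>)
  have "- (z * ?c) \<in> ?I"
    unfolding alt[symmetric] env.alternator_ideal_def env.ideal_generated_def
    by (rule hull_inc) auto
  then have "env_scale (- 6) (- (z * ?c)) \<in> ?I"
    by (rule env.subspace_scale[OF sI(1)])
  also have "env_scale (- 6) (- (z * ?c)) = ?e * ?c"
    unfolding e by (simp add: env.mult_scale_left)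
  also have e_comm: "?e * x = x * ?e" for x
    using U.central_mod(1)[OF U.zero_ideal gen, of m\<^sub>e x] e_M by (simp add: env.commutator_def)
  finally have ce: "?c * ?e \<in> ?I" .
  have "env.associator ?e x y = 0" for x y
    using U.central_mod(2)[OF U.zero_ideal gen, of m\<^sub>e x y] e_M by simp
  then have assoc: "x * y * ?e = x * (y * ?e)" "x * ?e * y = x * (?e * y)" for x y
    using U.M_cycle[OF gen, of x y m\<^sub>e] U.M_swap_left[OF gen, of x m\<^sub>e y]
    by (simp_all add: env.associator_def)
  \<comment> \<open>Writing one factor as \<open>[c, d]\<close> and using that the other is central
    and associates with everything turns \<open>e e\<close> into a difference of multiples of
    \<open>c e\<close>.\<close>
  have "?e * ?e = env.commutator ?c ?d * ?e"
    by (simp add: env_commutator_cases)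
  also have "\<dots> = ?c * ?e * ?d - ?d * (?c * ?e)"
    by (simp add: env.commutator_def env.mult_diff_left assoc e_comm)
  also have "\<dots> \<in> ?I"
    by (intro env.subspace_diff[OF sI(1)] sI(2,3) ce)
  finally have "?e * ?e \<in> ?I" .
  with ce show "env.ideal_generated {?c * ?e, ?e * ?e} \<subseteq> ?I"
    unfolding env.ideal_generated_def by (intro hull_minimal I) auto
qed

end
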